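(* Let $X(\le d)$ be a $\gamma$-HDX with $d \ge 2k$. Then the second largest singular value $\sigma_2(\mathsf{S}_{k,k})$ of the swap operator $\mathsf{S}_{k,k}$ is \[ \sigma_2(\mathsf{S}_{k,k}) ~\le~ \gamma \cdot \left(2^7 \cdot k^4 \cdot 2^{3k} \cdot k^{k}\right). \]
   Context: A simplicial complex $X$ on ground set $[n]$ is a downward-closed family of subsets (faces); $X(i)$ denotes the faces of cardinality $i$, and $X(\le d)$ is pure (every face lies in a face of size $d$). Given a probability measure $\Pi_d$ on $X(d)$, the measures $\Pi_i$ on $X(i)$ for $i<d$ are obtained by sampling $\mathfrak s^{(d)}\sim\Pi_d$ and repeatedly deleting a uniformly random element. $C^i$ denotes real functions on $X(i)$ with inner product $\langle f,g\rangle=\mathbb E_{\mathfrak s\sim\Pi_i}[f(\mathfrak s)g(\mathfrak s)]$. For a face $\mathfrak s$ with $|\mathfrak s|\le d-2$, the link is $X_{\mathfrak s}=\{\mathfrak t\setminus\mathfrak s : \mathfrak s\subseteq\mathfrak t\in X\}$ and its skeleton $G(X_{\mathfrak s})$ is the weighted graph with vertex set $X_{\mathfrak s}(1)$, edge set $X_{\mathfrak s}(2)$ and edge weights proportional to $\Pi_{|\mathfrak s|+2}$. $X(\le d)$ is a $\gamma$-HDX if for every $0\le i\le d-2$ and every $\mathfrak s\in X(i)$ the second singular value of the normalized adjacency matrix of $G(X_{\mathfrak s})$ is at most $\gamma$. The swap walk $\mathsf{S}_{k,l}$ from $X(k)$ to $X(l)$ (for $d\ge k+l$) is the Markov operator: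 from $\mathfrak s\in X(k)$, move up to $\mathfrak s''\in X(k+l)$ with $\mathfrak s''\supseteq\mathfrak s$, chosen with probability $\frac{1}{\binom{k+l}{l}}\cdot\frac{\Pi_{k+l}(\mathfrak s'')}{\Pi_k(\mathfrak s)}$, then deterministically go to $\mathfrak s''\setminus\mathfrak s\in X(l)$; it acts as an operator $C^l\to C^k$. Here $\mathsf{S}_{k,k}$ is this walk with $l=k$, and $\sigma_2$ denotes the second largest singular value. *)

theory Defs
  imports
    "HOL-Probability.Probability"
    "Jordan_Normal_Form.Char_Poly"
begin

section \<open>Singular values\<close>

text \<open>
  The singular values of \<open>A\<close> are the square roots of the eigenvalues of \<open>A\<^sup>T A\<close>, repeated
  according to multiplicity and listed in decreasing order. Since \<open>A\<^sup>T A\<close> is symmetric and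
  positive semidefinite, all roots of its characteristic polynomial are real and nonnegative and
  algebraic and geometric multiplicities agree.
\<close>

definition singular_values :: "real mat \<Rightarrow> real list" where
  "singular_values A =
     rev (sorted_list_of_multiset (image_mset sqrt (proots (char_poly (transpose_mat A * A)))))"

text \<open>A matrix with fewer than two columns has no second singular value; it is set to \<open>0\<close>.\<close>

definition sigma2 :: "real mat \<Rightarrow> real" where
  "sigma2 A = (if length (singular_values A) \<ge> 2 then singular_values A ! 1 else 0)"

text \<open>
  Matrices indexed by finite sets are turned into matrices indexed by initial segments of the
  naturals by means of an arbitrary enumeration. Another choice permutes rows and columns, which
  does not affect the singular values.
\<close>

definition enum_set :: "'a set \<Rightarrow> 'a list" where
  "enum_set A = (SOME xs. distinct xs \<and> set xs = A)"

definition indexed_mat :: "'a set \<Rightarrow> 'b set \<Rightarrow> ('a \<Rightarrow> 'b \<Rightarrow> real) \<Rightarrow> real mat" where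
  "indexed_mat A B M =
     Matrix.mat (card A) (card B) (\<lambda>(i, j). M (enum_set A ! i) (enum_set B ! j))"


section \<open>Operators between weighted function spaces\<close>

definition inner_pmf :: "'a pmf \<Rightarrow> ('a \<Rightarrow> real) \<Rightarrow> ('a \<Rightarrow> real) \<Rightarrow> real" where
  "inner_pmf p f g = measure_pmf.expectation p (\<lambda>s. f s * g s)"

text \<open>
  For \<open>a\<close> ranging over a finite set that carries \<open>p\<close>, the normalized indicators below form an
  orthonormal basis of the functions on this set with respect to \<open>inner_pmf p\<close>, provided that
  every point has positive mass. Because of \<open>x / 0 = 0\<close>, a point of mass \<open>0\<close> gives the zero
  function. It thus contributes only a zero row or a zero column to the matrix below.
\<close>

definition unit_fun :: "'a pmf \<Rightarrow> 'a \<Rightarrow> 'a \<Rightarrow> real" where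
  "unit_fun p a = (\<lambda>b. if b = a then 1 / sqrt (pmf p a) else 0)"

text \<open>
  The second singular value of an operator \<open>T\<close> from the functions on \<open>B\<close>, with inner product
  given by \<open>q\<close>, to the functions on \<open>A\<close>, with inner product given by \<open>p\<close>. Its matrix is taken
  with respect to orthonormal bases on both sides, so that the transpose of the matrix represents
  the adjoint of \<open>T\<close> for these inner products.
\<close>

definition op_sigma2 ::
    "'a set \<Rightarrow> 'a pmf \<Rightarrow> 'b set \<Rightarrow> 'b pmf \<Rightarrow> (('b \<Rightarrow> real) \<Rightarrow> ('a \<Rightarrow> real)) \<Rightarrow> real" where
  "op_sigma2 A p B q T =
     sigma2 (indexed_mat A B (\<lambda>a b. inner_pmf p (unit_fun p a) (T (unit_fun q b))))"


section \<open>Simplicial complexes\<close>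

definition simplicial_complex :: "nat \<Rightarrow> nat set set \<Rightarrow> bool" where
  "simplicial_complex n X \<longleftrightarrow> X \<subseteq> Pow {1..n} \<and> (\<forall>s\<in>X. \<forall>t. t \<subseteq> s \<longrightarrow> t \<in> X)"

text \<open>Faces are graded by cardinality, not by dimension: \<open>faces X i\<close> is \<open>X(i)\<close>.\<close>

definition faces :: "'a set set \<Rightarrow> nat \<Rightarrow> 'a set set" where
  "faces X i = {s \<in> X. card s = i}"

definition pure_up_to :: "'a set set \<Rightarrow> nat \<Rightarrow> bool" where
  "pure_up_to X d \<longleftrightarrow> (\<forall>s\<in>X. card s \<le> d \<longrightarrow> (\<exists>t\<in>faces X d. s \<subseteq> t))"

definition link :: "'a set set \<Rightarrow> 'a set \<Rightarrow> 'a set set" where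
  "link X s = {t - s |t. t \<in> X \<and> s \<subseteq> t}"

definition delete_random :: "'a set \<Rightarrow> 'a set pmf" where
  "delete_random s = map_pmf (\<lambda>x. s - {x}) (pmf_of_set s)"

text \<open>
  \<open>level_pmf d P i\<close> is \<open>\<Pi>\<^sub>i\<close> for \<open>i \<le> d\<close>, where \<open>P = \<Pi>\<^sub>d\<close> is a distribution on faces of size \<open>d\<close>.
\<close>

definition level_pmf :: "nat \<Rightarrow> 'a set pmf \<Rightarrow> nat \<Rightarrow> 'a set pmf" where
  "level_pmf d P i = ((\<lambda>p. bind_pmf p delete_random) ^^ (d - i)) P"


section \<open>High-dimensional expanders\<close>

text \<open>
  The normalized adjacency matrix \<open>D\<^sup>-\<^sup>1\<^sup>/\<^sup>2 W D\<^sup>-\<^sup>1\<^sup>/\<^sup>2\<close> of the graph with vertex set \<open>V\<close>,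
  edges \<open>E\<close> (two-element sets) and edge weights \<open>w\<close>, where \<open>D\<close> is the diagonal matrix of weighted
  degrees. It does not change when all weights are multiplied by a positive constant.
\<close>

definition edge_weight :: "'a set set \<Rightarrow> ('a set \<Rightarrow> real) \<Rightarrow> 'a \<Rightarrow> 'a \<Rightarrow> real" where
  "edge_weight E w u v = (if {u, v} \<in> E then w {u, v} else 0)"

definition weighted_degree :: "'a set \<Rightarrow> 'a set set \<Rightarrow> ('a set \<Rightarrow> real) \<Rightarrow> 'a \<Rightarrow> real" where
  "weighted_degree V E w u = (\<Sum>v\<in>V. edge_weight E w u v)"

definition normalized_adjacency :: "'a set \<Rightarrow> 'a set set \<Rightarrow> ('a set \<Rightarrow> real) \<Rightarrow> real mat" where
  "normalized_adjacency V E w =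
     indexed_mat V V (\<lambda>u v. edge_weight E w u v /
       (sqrt (weighted_degree V E w u) * sqrt (weighted_degree V E w v)))"

text \<open>
  The normalized adjacency matrix of \<open>G(X\<^sub>s)\<close>. A vertex \<open>{v} \<in> X\<^sub>s(1)\<close> is represented by \<open>v\<close>,
  and the edge \<open>e \<in> X\<^sub>s(2)\<close> has weight \<open>\<Pi>\<^sub>|\<^sub>s\<^sub>|\<^sub>+\<^sub>2 (s \<union> e)\<close>.
\<close>

definition link_adjacency :: "'a set set \<Rightarrow> nat \<Rightarrow> 'a set pmf \<Rightarrow> 'a set \<Rightarrow> real mat" where
  "link_adjacency X d P s =
     normalized_adjacency {v. {v} \<in> faces (link X s) 1} (faces (link X s) 2)
       (\<lambda>e. pmf (level_pmf d P (card s + 2)) (s \<union> e))"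

text \<open>
  The complex \<open>X(\<le>d)\<close> with \<open>\<Pi>\<^sub>d = P\<close> is a \<open>\<gamma>\<close>-HDX. Full support of \<open>P\<close> is not required. For a
  face \<open>s\<close> of measure zero all edge weights vanish and the matrix is \<open>0\<close>; in the link of any
  other face, vertices of measure zero only add zero rows and columns. In effect the condition
  concerns the subcomplex of faces of positive measure.
\<close>

definition is_HDX :: "nat \<Rightarrow> nat set set \<Rightarrow> nat \<Rightarrow> nat set pmf \<Rightarrow> real \<Rightarrow> bool" where
  "is_HDX n X d P \<gamma> \<longleftrightarrow>
     simplicial_complex n X \<and> pure_up_to X d \<and> set_pmf P \<subseteq> faces X d \<and>
     (\<forall>i. i + 2 \<le> d \<longrightarrow> (\<forall>s\<in>faces X i. sigma2 (link_adjacency X d P s) \<le> \<gamma>))"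


section \<open>Swap walks\<close>

definition swap_op ::
    "'a set set \<Rightarrow> nat \<Rightarrow> 'a set pmf \<Rightarrow> nat \<Rightarrow> nat \<Rightarrow> ('a set \<Rightarrow> real) \<Rightarrow> ('a set \<Rightarrow> real)" where
  "swap_op X d P k l f = (\<lambda>s. \<Sum>s'' | s'' \<in> faces X (k + l) \<and> s \<subseteq> s''.
     1 / real ((k + l) choose l) * (pmf (level_pmf d P (k + l)) s'' / pmf (level_pmf d P k) s) *
     f (s'' - s))"

definition swap_sigma2 :: "'a set set \<Rightarrow> nat \<Rightarrow> 'a set pmf \<Rightarrow> nat \<Rightarrow> nat \<Rightarrow> real" where
  "swap_sigma2 X d P k l =
     op_sigma2 (faces X k) (level_pmf d P k) (faces X l) (level_pmf d P l) (swap_op X d P k l)"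

end

theory Submission
  imports Defs "HOL-Combinatorics.Multiset_Permutations"
begin

text \<open>
  Reading a random face in random order turns the complex into an exchangeable sequence of
  vertices, and the swap walk pairs its first \<open>k\<close> entries with the next \<open>l\<close>. To bound
  \<open>E[f(x) g(y)]\<close> for mean-zero \<open>f\<close> and \<open>g\<close>, condition on the first entry \<open>v\<close> of \<open>y\<close>. The
  conditional means contribute the same expression for \<open>S\<^sub>k\<^sub>,\<^sub>1\<close>, and the centred parts contribute
  the expression for \<open>S\<^sub>k\<^sub>,\<^sub>l\<^sub>-\<^sub>1\<close> in the link of \<open>v\<close>. Hence, writing \<open>M\<^sub>k\<^sub>,\<^sub>l\<close> for the worst bound over all
  links, \<open>M\<^sub>k\<^sub>,\<^sub>l \<le> M\<^sub>k\<^sub>,\<^sub>1 + M\<^sub>k\<^sub>,\<^sub>l\<^sub>-\<^sub>1\<close>; since \<open>M\<^sub>k\<^sub>,\<^sub>1 = M\<^sub>1\<^sub>,\<^sub>k\<close> and \<open>M\<^sub>1\<^sub>,\<^sub>1 \<le> \<gamma>\<close>, this gives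
  \<open>\<sigma>\<^sub>2(S\<^sub>k\<^sub>,\<^sub>k) \<le> k\<^sup>2 \<gamma>\<close>, which is stronger than the claim. Bilinear bounds and second singular values are
  converted into each other by the Courant-Fischer argument, in both directions.
\<close>

no_notation inner (infix "\<bullet>" 70)
no_notation vec_nth (infixl "$" 90)

section \<open>Second singular values and quadratic forms\<close>

text \<open>The reflection that maps the first unit vector to the unit vector \<open>v\<close>. If these two
  coincide, the division by \<open>0\<close> makes it the identity, as desired.\<close>

definition householder :: "nat \<Rightarrow> real vec \<Rightarrow> real mat" where
  "householder n v = Matrix.mat n n (\<lambda>(i, j). (if i = j then 1 else 0)
     - (v $ i - (if i = 0 then 1 else 0)) * (v $ j - (if j = 0 then 1 else 0)) / (1 - v $ 0))"

lemma householder_carrier [simp]: "householder n v \<in> carrier_mat n n"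
  by (simp add: householder_def)

lemma transpose_householder [simp]: "transpose_mat (householder n v) = householder n v"
  by (auto simp: householder_def intro!: eq_matI)

text \<open>For \<open>w = v - e_0\<close> and \<open>r = 1 - v $ 0\<close>, the unit length of
  \<open>v\<close> gives |w|^2 = 2 r. So the matrix is I - 2 w w^T / |w|^2, an involution that
  exchanges e_0 and \<open>v\<close>.\<close>

lemma householder:
  assumes v: "v \<in> carrier_vec n" and unit: "v \<bullet> v = 1" and n: "0 < n"
  shows "householder n v * householder n v = 1\<^sub>m n" "col (householder n v) 0 = v"
proof -
  define w where "w = (\<lambda>i. v $ i - (if i = 0 then 1 else (0::real)))"
  define r where "r = 1 - v $ 0"
  have w2: "(\<Sum>i<n. w i * w i) = 2 * r"
  proof -
    have "(\<Sum>i<n. w i * w i) = (\<Sum>i<n. v $ i * v $ i - (if i = 0 then 2 * v $ 0 - 1 else 0))"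
      by (rule sum.cong) (auto simp: w_def algebra_simps)
    also have "\<dots> = (\<Sum>i<n. v $ i * v $ i) - (2 * v $ 0 - 1)"
      using n by (simp add: sum_subtractf)
    also have "(\<Sum>i<n. v $ i * v $ i) = 1"
      using unit v by (simp add: scalar_prod_def lessThan_atLeast0)
    finally show ?thesis by (simp add: r_def)
  qed
  have H: "householder n v = Matrix.mat n n (\<lambda>(i, j). (if i = j then 1 else 0) - w i * w j / r)"
    by (simp add: householder_def w_def r_def)
  \<comment> \<open>Division by \<open>r = 0\<close> is harmless: |w|^2 = 2 r then forces
    \<open>w\<close> to vanish, and the matrix is the identity.\<close>
  have r0: "w i = 0" if "r = 0" "i < n" for i
    using w2 that by (simp add: sum_nonneg_eq_0_iff)
  show "householder n v * householder n v = 1\<^sub>m n"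
  proof (rule eq_matI)
    fix i j assume "i < dim_row (1\<^sub>m n :: real mat)" "j < dim_col (1\<^sub>m n :: real mat)"
    then have i: "i < n" and j: "j < n" by auto
    have "(householder n v * householder n v) $$ (i, j) =
        (\<Sum>k<n. ((if i = k then 1 else 0) - w i * w k / r) * ((if k = j then 1 else 0) - w k * w j / r))"
      using i j by (simp add: H scalar_prod_def lessThan_atLeast0)
    also have "\<dots> = (\<Sum>k<n. (if i = k then (if k = j then 1 else 0) - w k * w j / r else 0)
        - (if k = j then w i * w j / r else 0) + w i * w j / r\<^sup>2 * (w k * w k))"
      by (rule sum.cong) (auto simp: algebra_simps power2_eq_square)
    also have "\<dots> = (if i = j then 1 else 0) - w i * w j / r - w i * w j / r
        + w i * w j / r\<^sup>2 * (2 * r)"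
    proof -
      have "(\<Sum>k<n. w i * w j / r\<^sup>2 * (w k * w k)) = w i * w j / r\<^sup>2 * (2 * r)"
        by (simp only: sum_distrib_left[symmetric] w2)
      moreover have "(\<Sum>k<n. if i = k then (if k = j then 1 else 0) - w k * w j / r else 0)
          = (if i = j then 1 else 0) - w i * w j / r"
        using i by (simp only: sum.delta' finite_lessThan) simp
      ultimately show ?thesis
        using i j by (simp add: sum.distrib sum_subtractf)
    qed
    also have "\<dots> = (if i = j then 1 else 0)"
      using r0[OF _ i] by (cases "r = 0") (auto simp: power2_eq_square field_simps)
    finally show "(householder n v * householder n v) $$ (i, j) = 1\<^sub>m n $$ (i, j)"
      using i j by simp
  qed (auto simp: householder_def)
  show "col (householder n v) 0 = v"
  proof (rule eq_vecI)
    fix i assume "i < dim_vec v"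
    then have i: "i < n" using v by simp
    have "w 0 / r = (if r = 0 then 0 else - 1)" by (auto simp: w_def r_def field_simps)
    then have "col (householder n v) 0 $ i = (if i = 0 then 1 else 0) + (if r = 0 then 0 else w i)"
      using i n by (auto simp: H simp flip: times_divide_eq_right)
    then show "col (householder n v) 0 $ i = v $ i"
      using r0[OF _ i] by (auto simp: w_def)
  qed (use v in \<open>auto simp: householder_def\<close>)
qed

text \<open>Over the complex numbers the polynomial splits. For an eigenvector \<open>v\<close> of a
  root \<open>c\<close>, moving the symmetric \<open>A\<close> across the Hermitian product gives c
  |v|^2 = cnj c |v|^2, so every root is real.\<close>

lemma real_symmetric_char_poly_splits:
  fixes A :: "real mat"
  assumes A: "A \<in> carrier_mat n n" and sym: "transpose_mat A = A"
  shows "\<exists>es. char_poly A = (\<Prod>e\<leftarrow>es. [:- e, 1:]) \<and> length es = n"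
proof -
  interpret of_real_poly: map_poly_inj_idom_hom "of_real :: real \<Rightarrow> complex" ..
  let ?C = "map_mat complex_of_real A"
  have C: "?C \<in> carrier_mat n n" using A by simp
  obtain cs where cs: "char_poly ?C = (\<Prod>a\<leftarrow>cs. [:- a, 1:])" "length cs = n"
    using char_poly_factorized[OF C] by blast
  have real: "of_real (Re c) = c" if c: "c \<in> set cs" for c
  proof -
    have "poly (char_poly ?C) c = 0"
      unfolding cs using c by (auto simp: poly_prod_list prod_list_zero_iff o_def)
    then obtain v where ev: "eigenvector ?C v c"
      using eigenvalue_root_char_poly[OF C] unfolding eigenvalue_def by blast
    then have v: "v \<in> carrier_vec n" and v0: "v \<noteq> 0\<^sub>v n" and Cv: "?C *\<^sub>v v = c \<cdot>\<^sub>v v"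
      using A unfolding eigenvector_def by auto
    have row: "(\<Sum>j<n. A $$ (i, j) * v $ j) = c * v $ i" if i: "i < n" for i
      using arg_cong[OF Cv, of "\<lambda>x. x $ i"] i v A
      by (simp add: scalar_prod_def lessThan_atLeast0)
    have symA: "A $$ (i, j) = A $$ (j, i)" if "i < n" "j < n" for i j
      using arg_cong[OF sym, of "\<lambda>x. x $$ (i, j)"] that A by simp
    define N where "N = (\<Sum>i<n. (cmod (v $ i))\<^sup>2)"
    have N: "of_real N = (\<Sum>i<n. v $ i * cnj (v $ i))"
      by (simp add: N_def complex_norm_square del: of_real_power)
    have "c * of_real N = (\<Sum>i<n. c * v $ i * cnj (v $ i))"
      by (simp add: N sum_distrib_left mult.assoc)
    also have "\<dots> = (\<Sum>i<n. \<Sum>j<n. A $$ (i, j) * v $ j * cnj (v $ i))"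
      by (rule sum.cong) (auto simp: row[symmetric] sum_distrib_right)
    also have "\<dots> = (\<Sum>j<n. \<Sum>i<n. A $$ (i, j) * v $ j * cnj (v $ i))"
      by (rule sum.swap)
    also have "\<dots> = (\<Sum>j<n. v $ j * cnj (\<Sum>i<n. A $$ (j, i) * v $ i))"
      by (rule sum.cong) (auto simp: sum_distrib_left symA intro!: sum.cong)
    also have "\<dots> = (\<Sum>j<n. v $ j * cnj (c * v $ j))"
      by (rule sum.cong) (auto simp: row)
    also have "\<dots> = cnj c * of_real N"
      by (simp add: N sum_distrib_left mult_ac)
    finally have eq: "c * of_real N = cnj c * of_real N" .
    have "N \<noteq> 0"
    proof
      assume "N = 0"
      then have "\<forall>i<n. v $ i = 0" by (simp add: N_def sum_nonneg_eq_0_iff)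
      then have "v = 0\<^sub>v n" using v by (intro eq_vecI) auto
      with v0 show False ..
    qed
    with eq have "c = cnj c" by simp
    then show ?thesis by (metis Reals_cnj_iff of_real_Re)
  qed
  \<comment> \<open>The factorization descends because the embedding of real into complex
    polynomials is injective.\<close>
  have "map_poly complex_of_real (char_poly A) = (\<Prod>a\<leftarrow>cs. [:- a, 1:])"
    using of_real_hom.char_poly_hom[OF A, where 'a = complex] cs by simp
  also have "\<dots> = (\<Prod>a\<leftarrow>cs. map_poly complex_of_real [:- Re a, 1:])"
    by (rule arg_cong[of _ _ prod_list], rule map_cong) (auto simp: real)
  also have "\<dots> = map_poly complex_of_real (\<Prod>e\<leftarrow>map Re cs. [:- e, 1:])"
    by (simp add: of_real_poly.hom_prod_list o_def)
  finally have "char_poly A = (\<Prod>e\<leftarrow>map Re cs. [:- e, 1:])"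
    by simp
  then show ?thesis using cs(2) by (intro exI[of _ "map Re cs"]) simp
qed


lemma exists_unit_eigenvector:
  fixes A :: "real mat"
  assumes A: "A \<in> carrier_mat n n" and e: "eigenvalue A e"
  shows "\<exists>v. v \<in> carrier_vec n \<and> v \<bullet> v = 1 \<and> A *\<^sub>v v = e \<cdot>\<^sub>v v"
proof -
  obtain v where v: "v \<in> carrier_vec n" and v0: "v \<noteq> 0\<^sub>v n" and Av: "A *\<^sub>v v = e \<cdot>\<^sub>v v"
    using e A unfolding eigenvalue_def eigenvector_def by auto
  define c where "c = 1 / sqrt (v \<bullet> v)"
  have "v \<bullet> v > 0"
    using conjugate_square_greater_0_vec[OF v] v0 by simp
  then have "c * (c * (v \<bullet> v)) = 1"
    by (simp add: c_def)
  moreover have "(c \<cdot>\<^sub>v v) \<bullet> (c \<cdot>\<^sub>v v) = c * (c * (v \<bullet> v))"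
    using v by simp
  moreover have "A *\<^sub>v (c \<cdot>\<^sub>v v) = e \<cdot>\<^sub>v (c \<cdot>\<^sub>v v)"
    using v A Av by (simp add: mult_mat_vec smult_smult_assoc mult.commute)
  ultimately show ?thesis
    using v by (intro exI[of _ "c \<cdot>\<^sub>v v"]) simp
qed

text \<open>Deflation: a reflection whose first column is a unit eigenvector for \<open>e\<close>
  conjugates \<open>A\<close> into a block matrix with blocks \<open>e\<close> and a smaller
  symmetric \<open>B3\<close>, to which the induction applies. Fixing the list \<open>es\<close> in
  advance prescribes the order of the diagonal, which is later chosen decreasing.\<close>

lemma symmetric_mat_diagonalization:
  fixes A :: "real mat"
  assumes "A \<in> carrier_mat n n" and "transpose_mat A = A"
    and "char_poly A = (\<Prod>e\<leftarrow>es. [:- e, 1:])"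
  shows "\<exists>U \<in> carrier_mat n n. transpose_mat U * U = 1\<^sub>m n \<and>
    transpose_mat U * A * U = Matrix.mat n n (\<lambda>(i, j). if i = j then es ! i else 0)"
  using assms
proof (induction es arbitrary: n A)
  case Nil
  with degree_monic_char_poly[OF Nil(1)] have "n = 0" by simp
  then show ?case by (intro bexI[of _ "1\<^sub>m n"]) auto
next
  case (Cons e es)
  note A = Cons.prems(1)
  have "degree (char_poly A) = n" using degree_monic_char_poly[OF A] by simp
  moreover have "degree (char_poly A) = Suc (length es)"
    unfolding Cons.prems(3) using degree_linear_factors[of uminus "e # es"] by simp
  ultimately have n: "n = Suc (length es)" by simp
  define m where "m = length es"
  have nm: "n = Suc m" using n by (simp add: m_def)
  have "eigenvalue A e"
    unfolding eigenvalue_root_char_poly[OF A] Cons.prems(3) by simp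
  then obtain v where v: "v \<in> carrier_vec n" "v \<bullet> v = 1" and Av: "A *\<^sub>v v = e \<cdot>\<^sub>v v"
    using exists_unit_eigenvector[OF A] by blast
  define W where "W = householder n v"
  have W: "W \<in> carrier_mat n n" "transpose_mat W = W" "W * W = 1\<^sub>m n" "col W 0 = v"
    using householder[OF v] n by (auto simp: W_def)
  define B where "B = W * A * W"
  have B: "B \<in> carrier_mat n n" using A W by (simp add: B_def)
  have symB: "transpose_mat B = B"
    using A W Cons.prems(2) by (simp add: B_def transpose_mult[of _ n n _ n])
  \<comment> \<open>\<open>W\<close> sends e_0 to \<open>v\<close> and, being an involution,
    \<open>v\<close> back to e_0; hence \<open>B\<close> sends e_0 to \<open>e\<close> times
    e_0.\<close>
  have "col B 0 = W *\<^sub>v (A *\<^sub>v v)"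
  proof -
    have "col B 0 = (W * A) *\<^sub>v col W 0"
      unfolding B_def using A W n by (intro col_mult2) auto
    also have "\<dots> = W *\<^sub>v (A *\<^sub>v v)"
      unfolding W(4) using A W v by (intro assoc_mult_mat_vec) auto
    finally show ?thesis .
  qed
  also have "\<dots> = e \<cdot>\<^sub>v (W *\<^sub>v v)"
    using W v by (simp add: Av mult_mat_vec)
  also have "W *\<^sub>v v = col (W * W) 0"
    unfolding W(4)[symmetric] using W(1) n by (intro col_mult2[symmetric]) auto
  finally have colB: "col B 0 = e \<cdot>\<^sub>v unit_vec n 0"
    using W n by simp
  have B0: "B $$ (i, 0) = (if i = 0 then e else 0)" if "i < n" for i
    using arg_cong[OF colB, of "\<lambda>x. x $ i"] that B n by simp
  have B0': "B $$ (0, i) = (if i = 0 then e else 0)" if "i < n" for i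
    using B0[OF that] arg_cong[OF symB, of "\<lambda>x. x $$ (i, 0)"] that B n by simp
  define B3 where "B3 = Matrix.mat m m (\<lambda>(i, j). B $$ (Suc i, Suc j))"
  have B3: "B3 \<in> carrier_mat m m" by (simp add: B3_def)
  let ?E = "Matrix.mat 1 1 (\<lambda>_. e)"
  have Bblock: "B = four_block_mat ?E (0\<^sub>m 1 m) (0\<^sub>m m 1) B3"
    using B B0 B0' by (intro eq_matI) (auto simp: nm B3_def)
  have symB3: "transpose_mat B3 = B3"
  proof (rule eq_matI)
    fix i j assume "i < dim_row B3" "j < dim_col B3"
    then show "transpose_mat B3 $$ (i, j) = B3 $$ (i, j)"
      using arg_cong[OF symB, of "\<lambda>x. x $$ (Suc i, Suc j)"] B by (simp add: B3_def nm)
  qed (simp_all add: B3_def)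
  \<comment> \<open>\<open>W\<close> is its own inverse, so conjugation by it keeps the
    characteristic polynomial; cancelling the factor of \<open>e\<close> leaves that of
    \<open>B3\<close>.\<close>
  have "similar_mat_wit B A W W"
    using A B W by (intro similar_mat_witI[of W W n B A]) (auto simp: B_def)
  then have "similar_mat B A"
    unfolding similar_mat_def by blast
  then have "char_poly A = char_poly B" by (simp add: char_poly_similar)
  also have "\<dots> = char_poly ?E * char_poly B3"
    unfolding Bblock by (rule char_poly_four_block_zeros_col) (auto simp: B3)
  also have "char_poly ?E = [:- e, 1:]"
    by (simp add: char_poly_defs det_def sign_def)
  finally have "[:- e, 1:] * char_poly B3 = [:- e, 1:] * (\<Prod>e\<leftarrow>es. [:- e, 1:])"
    using Cons.prems(3) by simp
  then have "char_poly B3 = (\<Prod>e\<leftarrow>es. [:- e, 1:])"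
    by (metis mult_cancel_left pCons_eq_0_iff zero_neq_one)
  from Cons.IH[OF B3 symB3 this] obtain V where V: "V \<in> carrier_mat m m"
    and VV: "transpose_mat V * V = 1\<^sub>m m"
    and VBV: "transpose_mat V * B3 * V = Matrix.mat m m (\<lambda>(i, j). if i = j then es ! i else 0)"
    by blast
  define F where "F = four_block_mat (1\<^sub>m 1) (0\<^sub>m 1 m) (0\<^sub>m m 1) V"
  have F: "F \<in> carrier_mat n n" using V by (auto simp: F_def nm)
  have FT: "transpose_mat F = four_block_mat (1\<^sub>m 1) (0\<^sub>m 1 m) (0\<^sub>m m 1) (transpose_mat V)"
    using V by (simp add: F_def transpose_four_block_mat[of _ 1 1 _ m _ m])
  have FF: "transpose_mat F * F = 1\<^sub>m n"
    unfolding FT unfolding F_def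
    using V VV by (subst mult_four_block_mat[of _ 1 1 _ m _ m _ _ 1 _ m]) (auto simp: nm)
  have FBF: "transpose_mat F * B * F =
      four_block_mat ?E (0\<^sub>m 1 m) (0\<^sub>m m 1) (transpose_mat V * B3 * V)"
    unfolding FT Bblock unfolding F_def
    using V B3 
    by (subst mult_four_block_mat[of _ 1 1 _ m _ m _ _ 1 _ m], auto)
      (subst mult_four_block_mat[of _ 1 1 _ m _ m _ _ 1 _ m], auto)
  have UT: "transpose_mat (W * F) = transpose_mat F * W"
    using W F by (simp add: transpose_mult[of _ n n _ n])
  have "transpose_mat (W * F) * (W * F) = transpose_mat F * (W * W) * F"
    unfolding UT using W(1) F by (simp add: assoc_mult_mat[of _ _ n _ n _ n])
  then have UU: "transpose_mat (W * F) * (W * F) = 1\<^sub>m n"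
    using W FF F by simp
  have "transpose_mat (W * F) * A * (W * F) = transpose_mat F * B * F"
    unfolding UT B_def using W(1) F A by (simp add: assoc_mult_mat[of _ _ n _ n _ n])
  also have "\<dots> = Matrix.mat n n (\<lambda>(i, j). if i = j then (e # es) ! i else 0)"
    unfolding FBF VBV by (intro eq_matI) (auto simp: nm nth_Cons')
  finally show ?case
    using UU W(1) F by (intro bexI[of _ "W * F"]) auto
qed

text \<open>\<open>A\<close> and \<open>U\<close> move across the inner product as transposes, which
  leaves the diagonal matrix or the identity between two copies of \<open>y\<close>. The
  Courant-Fischer arguments work in these coordinates.\<close>

lemma diagonalization_quadratic_form:
  fixes A :: "real mat"
  assumes A: "A \<in> carrier_mat m n" and U: "U \<in> carrier_mat n n"
    and UU: "transpose_mat U * U = 1\<^sub>m n"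
    and D: "transpose_mat U * (transpose_mat A * A) * U =
      Matrix.mat n n (\<lambda>(i, j). if i = j then es ! i else 0)"
    and y: "y \<in> carrier_vec n"
  shows "(A *\<^sub>v (U *\<^sub>v y)) \<bullet> (A *\<^sub>v (U *\<^sub>v y)) = (\<Sum>i<n. es ! i * (y $ i)\<^sup>2)"
    and "(U *\<^sub>v y) \<bullet> (U *\<^sub>v y) = (\<Sum>i<n. (y $ i)\<^sup>2)"
proof -
  have adj: "(M *\<^sub>v x) \<bullet> z = x \<bullet> (transpose_mat M *\<^sub>v z)"
    if "M \<in> carrier_mat k l" "x \<in> carrier_vec l" "z \<in> carrier_vec k"
    for M :: "real mat" and x z k l
    using that transpose_vec_mult_scalar[of "M" k l x z] comm_scalar_prod[of "M *\<^sub>v x" k z]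
      comm_scalar_prod[of "transpose_mat M *\<^sub>v z" l x]
    by (metis mult_mat_vec_carrier transpose_carrier_mat)
  let ?x = "U *\<^sub>v y"
  have x: "?x \<in> carrier_vec n" using U y by simp
  have "(A *\<^sub>v ?x) \<bullet> (A *\<^sub>v ?x) = ?x \<bullet> (transpose_mat A *\<^sub>v (A *\<^sub>v ?x))"
    using A x by (intro adj) auto
  also have "\<dots> = y \<bullet> (transpose_mat U *\<^sub>v (transpose_mat A *\<^sub>v (A *\<^sub>v ?x)))"
    using A U y by (intro adj) auto
  also have "transpose_mat U *\<^sub>v (transpose_mat A *\<^sub>v (A *\<^sub>v ?x)) =
      (transpose_mat U * (transpose_mat A * A) * U) *\<^sub>v y"
  proof -
    have "transpose_mat A *\<^sub>v (A *\<^sub>v ?x) = (transpose_mat A * A) *\<^sub>v ?x"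
      by (rule assoc_mult_mat_vec[symmetric]) (use A U x in auto)
    moreover have "(transpose_mat U * (transpose_mat A * A) * U) *\<^sub>v y =
        (transpose_mat U * (transpose_mat A * A)) *\<^sub>v ?x"
      by (rule assoc_mult_mat_vec) (use A U y in auto)
    moreover have "\<dots> = transpose_mat U *\<^sub>v ((transpose_mat A * A) *\<^sub>v ?x)"
      by (rule assoc_mult_mat_vec) (use A U x in auto)
    ultimately show ?thesis by simp
  qed
  also have "y \<bullet> ((transpose_mat U * (transpose_mat A * A) * U) *\<^sub>v y) = (\<Sum>i<n. es ! i * (y $ i)\<^sup>2)"
  proof -
    have "(Matrix.mat n n (\<lambda>(i, j). if i = j then es ! i else 0) *\<^sub>v y) $ i = es ! i * y $ i"
      if "i < n" for i
      using that y by (simp add: scalar_prod_def if_distrib[of "\<lambda>x. x * _"] cong: if_cong)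
    then show ?thesis
      unfolding D scalar_prod_def using y
      by (auto simp: lessThan_atLeast0 power2_eq_square intro!: sum.cong)
  qed
  finally show "(A *\<^sub>v ?x) \<bullet> (A *\<^sub>v ?x) = (\<Sum>i<n. es ! i * (y $ i)\<^sup>2)" .
  have "?x \<bullet> ?x = y \<bullet> (transpose_mat U *\<^sub>v ?x)"
    using U x y by (intro adj) auto
  also have "transpose_mat U *\<^sub>v ?x = (transpose_mat U * U) *\<^sub>v y"
    by (rule assoc_mult_mat_vec[symmetric]) (use U y in auto)
  also have "\<dots> = y" unfolding UU using y by simp
  also have "y \<bullet> y = (\<Sum>i<n. (y $ i)\<^sup>2)"
    using y by (simp add: scalar_prod_def lessThan_atLeast0 power2_eq_square)
  finally show "?x \<bullet> ?x = (\<Sum>i<n. (y $ i)\<^sup>2)" .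
qed

section \<open>From the diagonalized Gram matrix to the list of singular values\<close>

lemma proots_prod_linear_factors:
  fixes es :: "'a :: idom list"
  shows "proots (\<Prod>e\<leftarrow>es. [:- e, 1:]) = mset es"
proof (induction es)
  case (Cons e es)
  have "(\<Prod>e\<leftarrow>es. [:- e, 1:]) \<noteq> 0" by (auto simp: prod_list_zero_iff)
  then have "proots ([:- e, 1:] * (\<Prod>e\<leftarrow>es. [:- e, 1:])) = proots [:- e, 1:] + mset es"
    using Cons.IH by (subst proots_mult) auto
  then show ?case by simp
qed simp

text \<open>The roots are sorted before diagonalizing, so the diagonal and the singular values run
  in the same order; \<open>sqrt\<close> is monotone and keeps it. Entry \<open>i\<close> is the
  squared length of \<open>A\<close> applied to column \<open>i\<close> of \<open>U\<close>, hence
  nonnegative.\<close>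

lemma singular_values_diagonalization:
  assumes A: "A \<in> carrier_mat m n"
  obtains U es where "U \<in> carrier_mat n n" "transpose_mat U * U = 1\<^sub>m n"
    "transpose_mat U * (transpose_mat A * A) * U =
      Matrix.mat n n (\<lambda>(i, j). if i = j then es ! i else 0)"
    "length es = n" "sorted_wrt (\<ge>) es" "\<forall>i<n. 0 \<le> es ! i"
    "singular_values A = map sqrt es"
proof -
  let ?S = "transpose_mat A * A"
  have S: "?S \<in> carrier_mat n n" using A by simp
  have symS: "transpose_mat ?S = ?S" using A by (simp add: transpose_mult[of _ n m _ n])
  obtain fs where fs: "char_poly ?S = (\<Prod>e\<leftarrow>fs. [:- e, 1:])" "length fs = n"
    using real_symmetric_char_poly_splits[OF S symS] by blast
  define es where "es = rev (sort fs)"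
  have "(\<Prod>e\<leftarrow>fs. [:- e, 1:]) = (\<Prod>e\<leftarrow>es. [:- e, 1:])"
    unfolding prod_mset_prod_list[symmetric] mset_map es_def by simp
  with fs have cp: "char_poly ?S = (\<Prod>e\<leftarrow>es. [:- e, 1:])" by simp
  have len: "length es = n" using fs by (simp add: es_def)
  obtain U where U: "U \<in> carrier_mat n n" "transpose_mat U * U = 1\<^sub>m n"
    "transpose_mat U * ?S * U = Matrix.mat n n (\<lambda>(i, j). if i = j then es ! i else 0)"
    using symmetric_mat_diagonalization[OF S symS cp] by blast
  have "0 \<le> es ! i" if i: "i < n" for i
  proof -
    have "(\<Sum>j<n. es ! j * (unit_vec n i $ j)\<^sup>2) = (\<Sum>j<n. if j = i then es ! j else 0)"
      by (rule sum.cong) (use i in auto)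
    also have "\<dots> = es ! i" using i by simp
    finally have "es ! i = (A *\<^sub>v (U *\<^sub>v unit_vec n i)) \<bullet> (A *\<^sub>v (U *\<^sub>v unit_vec n i))"
      using diagonalization_quadratic_form(1)[OF A U, of "unit_vec n i"] by simp
    also have "\<dots> \<ge> 0" by (simp add: scalar_prod_def sum_nonneg)
    finally show ?thesis .
  qed
  moreover have "singular_values A = map sqrt es"
  proof -
    have "proots (char_poly ?S) = mset es"
      unfolding cp by (rule proots_prod_linear_factors)
    then have "singular_values A = rev (sort (map sqrt es))"
      unfolding singular_values_def by (simp flip: mset_map)
    moreover have "sort (map sqrt es) = map sqrt (sort fs)"
      by (rule properties_for_sort) (auto simp: es_def sorted_map intro: sorted_wrt_mono_rel[OF _ sorted_sort])
    ultimately show ?thesis by (simp add: es_def rev_map)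
  qed
  moreover have "sorted_wrt (\<ge>) es"
    by (simp add: es_def sorted_wrt_rev)
  ultimately show thesis using U len by (intro that) auto
qed

section \<open>Courant-Fischer bounds for the second singular value\<close>

lemma sigma2_nonneg: "0 \<le> sigma2 A"
proof -
  define m n where "m = dim_row A" and "n = dim_col A"
  have A: "A \<in> carrier_mat m n" by (simp add: m_def n_def)
  obtain U es where "U \<in> carrier_mat n n" "transpose_mat U * U = 1\<^sub>m n"
    "transpose_mat U * (transpose_mat A * A) * U =
      Matrix.mat n n (\<lambda>(i, j). if i = j then es ! i else 0)"
    "length es = n" "sorted_wrt (\<ge>) es" "\<forall>i<n. 0 \<le> es ! i"
    "singular_values A = map sqrt es"
    by (rule singular_values_diagonalization[OF A]) blast
  then show ?thesis by (simp add: sigma2_def)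
qed

text \<open>The span of the top two right singular vectors meets the hyperplane orthogonal to
  \<open>u\<close> in a nonzero vector. \<open>A\<close> stretches it by at least the second
  singular value and, by assumption, by at most \<open>c\<close>.\<close>

lemma sigma2_le:
  assumes A: "A \<in> carrier_mat m n" and u: "u \<in> carrier_vec n" and c: "0 \<le> c"
    and bound: "\<And>x. x \<in> carrier_vec n \<Longrightarrow> u \<bullet> x = 0 \<Longrightarrow> (A *\<^sub>v x) \<bullet> (A *\<^sub>v x) \<le> c\<^sup>2 * (x \<bullet> x)"
  shows "sigma2 A \<le> c"
proof -
  obtain U es where U: "U \<in> carrier_mat n n" "transpose_mat U * U = 1\<^sub>m n"
    "transpose_mat U * (transpose_mat A * A) * U =
      Matrix.mat n n (\<lambda>(i, j). if i = j then es ! i else 0)"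
    and es: "length es = n" "sorted_wrt (\<ge>) es" "\<forall>i<n. 0 \<le> es ! i"
      "singular_values A = map sqrt es"
    by (rule singular_values_diagonalization[OF A]) blast
  show ?thesis
  proof (cases "2 \<le> n")
    case False
    then show ?thesis using es c by (simp add: sigma2_def)
  next
    case True
    then have n: "0 < n" "1 < n" by auto
    \<comment> \<open>\<open>w\<close> holds the coordinates of \<open>u\<close> in the basis
      \<open>U\<close>; the nonzero pair \<open>(a, b)\<close> combines the first two basis vectors
      orthogonally to \<open>u\<close>.\<close>
    define w where "w = transpose_mat U *\<^sub>v u"
    have w: "w \<in> carrier_vec n" using U u by (simp add: w_def)
    obtain a b where ab: "a * w $ 0 + b * w $ 1 = 0" "(a, b) \<noteq> (0, 0)"
    proof (cases "w $ 0 = 0 \<and> w $ 1 = 0")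
      case True
      then show ?thesis using that[of 1 0] by simp
    next
      case False
      then show ?thesis using that[of "w $ 1" "- w $ 0"] by auto
    qed
    define y where "y = Matrix.vec n (\<lambda>i. if i = 0 then a else if i = 1 then b else 0)"
    have y: "y \<in> carrier_vec n" by (simp add: y_def)
    have two: "(\<Sum>i<n. h i) = h 0 + h 1" if "\<And>i. 2 \<le> i \<Longrightarrow> i < n \<Longrightarrow> h i = 0" for h :: "nat \<Rightarrow> real"
    proof -
      have "(\<Sum>i<n. h i) = (\<Sum>i\<in>{0, 1}. h i)"
        by (rule sum.mono_neutral_right) (use n that in auto)
      then show ?thesis by simp
    qed
    have "u \<bullet> (U *\<^sub>v y) = w \<bullet> y"
      unfolding w_def using U u y transpose_vec_mult_scalar[of U n n y u] by simp
    also have "\<dots> = (\<Sum>i<n. w $ i * y $ i)"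
      using y by (simp add: scalar_prod_def lessThan_atLeast0)
    also have "\<dots> = 0"
      by (subst two) (use n ab in \<open>auto simp: y_def mult.commute\<close>)
    finally have "(A *\<^sub>v (U *\<^sub>v y)) \<bullet> (A *\<^sub>v (U *\<^sub>v y)) \<le> c\<^sup>2 * ((U *\<^sub>v y) \<bullet> (U *\<^sub>v y))"
      using U y by (intro bound) auto
    then have "es ! 0 * a\<^sup>2 + es ! 1 * b\<^sup>2 \<le> c\<^sup>2 * (a\<^sup>2 + b\<^sup>2)"
      unfolding diagonalization_quadratic_form[OF A U y] using n
      by (subst (asm) two, simp add: y_def, subst (asm) two) (simp_all add: y_def)
    moreover have "es ! 1 * a\<^sup>2 \<le> es ! 0 * a\<^sup>2"
      using sorted_wrt_nth_less[OF es(2), of 0 1] n es(1) by (intro mult_right_mono) auto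
    ultimately have "es ! 1 * (a\<^sup>2 + b\<^sup>2) \<le> c\<^sup>2 * (a\<^sup>2 + b\<^sup>2)"
      by (simp add: algebra_simps)
    moreover have "a\<^sup>2 + b\<^sup>2 > 0"
      using ab by (auto simp: sum_power2_gt_zero_iff)
    ultimately have "es ! 1 \<le> c\<^sup>2" by simp
    then have "sqrt (es ! 1) \<le> c" using c by (simp add: real_le_lsqrt es(3) n)
    then show ?thesis using True es by (simp add: sigma2_def)
  qed
qed

text \<open>The vector \<open>u\<close> has singular value 1, the largest possible for a
  contraction. If \<open>x\<close> violated the bound, so would every nonzero vector in the plane of
  \<open>u\<close> and \<open>x\<close>; but this plane meets the orthogonal complement of the first
  column of \<open>U\<close>, where the bound holds.\<close>

lemma norm_mult_mat_vec_le_sigma2: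
  assumes A: "A \<in> carrier_mat m n" and u: "u \<in> carrier_vec n" "0 < u \<bullet> u"
    and fix_u: "transpose_mat A *\<^sub>v (A *\<^sub>v u) = u"
    and contraction: "\<And>x. x \<in> carrier_vec n \<Longrightarrow> (A *\<^sub>v x) \<bullet> (A *\<^sub>v x) \<le> x \<bullet> x"
    and x: "x \<in> carrier_vec n" "u \<bullet> x = 0"
  shows "(A *\<^sub>v x) \<bullet> (A *\<^sub>v x) \<le> (sigma2 A)\<^sup>2 * (x \<bullet> x)"
proof (rule ccontr)
  assume neg: "\<not> ?thesis"
  obtain U es where U: "U \<in> carrier_mat n n" "transpose_mat U * U = 1\<^sub>m n"
    "transpose_mat U * (transpose_mat A * A) * U =
      Matrix.mat n n (\<lambda>(i, j). if i = j then es ! i else 0)"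
    and es: "length es = n" "sorted_wrt (\<ge>) es" "\<forall>i<n. 0 \<le> es ! i"
      "singular_values A = map sqrt es"
    by (rule singular_values_diagonalization[OF A]) blast
  have xx: "0 \<le> x \<bullet> x" by (simp add: scalar_prod_def sum_nonneg)
  have xpos: "0 < x \<bullet> x"
  proof (rule ccontr)
    assume "\<not> 0 < x \<bullet> x"
    with xx contraction[OF x(1)] neg show False
      by (auto simp: not_less not_le)
  qed
  have UU': "U * transpose_mat U = 1\<^sub>m n"
    using mat_mult_left_right_inverse[of "transpose_mat U" n U] U by simp
  have Ux: "U *\<^sub>v (transpose_mat U *\<^sub>v z) = z" if "z \<in> carrier_vec n" for z
    using that U UU' assoc_mult_mat_vec[of U n n "transpose_mat U" n z] by simp
  define p where "p = transpose_mat U *\<^sub>v u"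
  define q where "q = transpose_mat U *\<^sub>v x"
  have p: "p \<in> carrier_vec n" and q: "q \<in> carrier_vec n" using U u x by (simp_all add: p_def q_def)
  have n: "0 < n" using u by (cases n) (auto simp: scalar_prod_def)
  have Uv: "U *\<^sub>v p = u" "U *\<^sub>v q = x" using Ux u x by (simp_all add: p_def q_def)
  \<comment> \<open>Coefficients for which the combination of \<open>u\<close> and \<open>x\<close>
    has coordinate 0 along the first column of \<open>U\<close>.\<close>
  obtain a b where ab: "a * p $ 0 + b * q $ 0 = 0" "(a, b) \<noteq> (0, 0)"
  proof (cases "p $ 0 = 0 \<and> q $ 0 = 0")
    case True
    then show ?thesis using that[of 1 0] by simp
  next
    case False
    then show ?thesis using that[of "q $ 0" "- p $ 0"] by auto
  qed
  define y where "y = a \<cdot>\<^sub>v p + b \<cdot>\<^sub>v q"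
  have y: "y \<in> carrier_vec n" using p q by (simp add: y_def)
  have y0: "y $ 0 = 0" using p q n ab by (simp add: y_def)
  define z where "z = a \<cdot>\<^sub>v u + b \<cdot>\<^sub>v x"
  have Uy: "U *\<^sub>v y = z"
    using U p q by (simp add: y_def z_def mult_add_distrib_mat_vec[of _ n n] mult_mat_vec[of _ n n] Uv)
  have quad: "(a \<cdot>\<^sub>v r + b \<cdot>\<^sub>v s) \<bullet> (a \<cdot>\<^sub>v r + b \<cdot>\<^sub>v s) = a\<^sup>2 * (r \<bullet> r) + b\<^sup>2 * (s \<bullet> s)"
    if "r \<in> carrier_vec k" "s \<in> carrier_vec k" "r \<bullet> s = 0" for r s :: "real vec" and k
  proof -
    have "s \<bullet> r = 0" using that comm_scalar_prod[of r k s] by simp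
    then show ?thesis
      using that by (simp add: scalar_prod_add_distrib[of _ k] add_scalar_prod_distrib[of _ k] power2_eq_square)
  qed
  have zz: "z \<bullet> z = a\<^sup>2 * (u \<bullet> u) + b\<^sup>2 * (x \<bullet> x)"
    unfolding z_def by (rule quad) (use u x in auto)
  \<comment> \<open>The Gram matrix fixes \<open>u\<close>, so the images of \<open>u\<close> and
    \<open>x\<close> stay orthogonal and the quadratic form has no mixed term on the plane.\<close>
  have gram: "(A *\<^sub>v u) \<bullet> (A *\<^sub>v r) = u \<bullet> r" if r: "r \<in> carrier_vec n" for r
    using transpose_vec_mult_scalar[of A m n r "A *\<^sub>v u"] A u r by (simp add: fix_u)
  have "A *\<^sub>v z = a \<cdot>\<^sub>v (A *\<^sub>v u) + b \<cdot>\<^sub>v (A *\<^sub>v x)"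
    using A u x by (simp add: z_def mult_add_distrib_mat_vec[of _ m n] mult_mat_vec[of _ m n])
  then have Azz: "(A *\<^sub>v z) \<bullet> (A *\<^sub>v z) = a\<^sup>2 * (u \<bullet> u) + b\<^sup>2 * ((A *\<^sub>v x) \<bullet> (A *\<^sub>v x))"
    using quad[of "A *\<^sub>v u" m "A *\<^sub>v x"] gram A u x by simp
  have s1: "es ! i \<le> (sigma2 A)\<^sup>2" if i: "0 < i" "i < n" for i
  proof -
    have n2: "2 \<le> n" using i by simp
    have "es ! i \<le> es ! 1"
      using sorted_wrt_nth_less[OF es(2), of 1 i] i es(1) by (cases "i = 1") auto
    also have "\<dots> = (sigma2 A)\<^sup>2"
      using es n2 by (simp add: sigma2_def)
    finally show ?thesis .
  qed
  have "(A *\<^sub>v z) \<bullet> (A *\<^sub>v z) \<le> (sigma2 A)\<^sup>2 * (z \<bullet> z)"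
    unfolding Uy[symmetric] diagonalization_quadratic_form[OF A U y] sum_distrib_left
  proof (rule sum_mono)
    fix i assume "i \<in> {..<n}"
    then show "es ! i * (y $ i)\<^sup>2 \<le> (sigma2 A)\<^sup>2 * (y $ i)\<^sup>2"
      using s1[of i] y0 by (cases "i = 0") (auto intro: mult_right_mono)
  qed
  \<comment> \<open>Otherwise the contraction property alone would bound \<open>x\<close>, against
    \<open>neg\<close>.\<close>
  moreover have "(sigma2 A)\<^sup>2 < 1"
  proof (rule ccontr)
    assume "\<not> (sigma2 A)\<^sup>2 < 1"
    then have "1 * (x \<bullet> x) \<le> (sigma2 A)\<^sup>2 * (x \<bullet> x)"
      using xx by (intro mult_right_mono) auto
    with contraction[OF x(1)] neg show False by simp
  qed
  ultimately have *: "a\<^sup>2 * (u \<bullet> u) + b\<^sup>2 * ((A *\<^sub>v x) \<bullet> (A *\<^sub>v x))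
      \<le> a\<^sup>2 * ((sigma2 A)\<^sup>2 * (u \<bullet> u)) + b\<^sup>2 * ((sigma2 A)\<^sup>2 * (x \<bullet> x))"
    and less: "(sigma2 A)\<^sup>2 < 1"
    unfolding Azz zz by (simp_all add: algebra_simps)
  have 1: "(sigma2 A)\<^sup>2 * (u \<bullet> u) < u \<bullet> u" using less u by simp
  have 2: "(sigma2 A)\<^sup>2 * (x \<bullet> x) < (A *\<^sub>v x) \<bullet> (A *\<^sub>v x)" using neg by simp
  have "a\<^sup>2 * ((sigma2 A)\<^sup>2 * (u \<bullet> u)) + b\<^sup>2 * ((sigma2 A)\<^sup>2 * (x \<bullet> x))
      < a\<^sup>2 * (u \<bullet> u) + b\<^sup>2 * ((A *\<^sub>v x) \<bullet> (A *\<^sub>v x))"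
  proof (cases "a = 0")
    case True
    then show ?thesis using ab 2 by simp
  next
    case False
    then show ?thesis
      by (intro add_less_le_mono mult_strict_left_mono mult_left_mono 1 less_imp_le[OF 2]) simp_all
  qed
  with * show False by simp
qed

section \<open>Matrices and vectors indexed by finite sets\<close>

lemma enum_set:
  assumes "finite A"
  shows "distinct (enum_set A)" "set (enum_set A) = A" "length (enum_set A) = card A"
proof -
  have "distinct (enum_set A) \<and> set (enum_set A) = A"
    unfolding enum_set_def by (rule someI_ex) (use finite_distinct_list[OF assms] in blast)
  then show "distinct (enum_set A)" "set (enum_set A) = A" by auto
  then show "length (enum_set A) = card A" using distinct_card[of "enum_set A"] by simp
qed

lemma bij_betw_enum_set: "finite A \<Longrightarrow> bij_betw (\<lambda>i. enum_set A ! i) {..<card A} A"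
  using bij_betw_nth[of "enum_set A"] enum_set[of A] by simp

lemma sum_enum_set: "finite A \<Longrightarrow> (\<Sum>i<card A. h (enum_set A ! i)) = sum h A"
  by (rule sum.reindex_bij_betw[OF bij_betw_enum_set])

definition indexed_vec :: "'a set \<Rightarrow> ('a \<Rightarrow> real) \<Rightarrow> real vec" where
  "indexed_vec A h = Matrix.vec (card A) (\<lambda>i. h (enum_set A ! i))"

lemma indexed_vec_carrier [simp]: "indexed_vec A h \<in> carrier_vec (card A)"
  by (simp add: indexed_vec_def)

lemma indexed_mat_carrier [simp]: "indexed_mat A B K \<in> carrier_mat (card A) (card B)"
  by (simp add: indexed_mat_def)

lemma indexed_vec_cong:
  assumes "finite A" "\<And>a. a \<in> A \<Longrightarrow> g a = h a"
  shows "indexed_vec A g = indexed_vec A h"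
  using assms bij_betwE[OF bij_betw_enum_set[of A]] by (auto simp: indexed_vec_def)

lemma indexed_vec_surj:
  assumes "finite A" "x \<in> carrier_vec (card A)"
  obtains h where "x = indexed_vec A h"
proof
  let ?e = "\<lambda>i. enum_set A ! i"
  have "inj_on ?e {..<card A}" using bij_betw_enum_set[OF assms(1)] by (simp add: bij_betw_def)
  then show "x = indexed_vec A (\<lambda>a. x $ inv_into {..<card A} ?e a)"
    using assms by (intro eq_vecI) (auto simp: indexed_vec_def)
qed

lemma scalar_prod_indexed_vec:
  "finite A \<Longrightarrow> indexed_vec A g \<bullet> indexed_vec A h = (\<Sum>a\<in>A. g a * h a)"
  using sum_enum_set[of A "\<lambda>a. g a * h a"]
  by (simp add: indexed_vec_def scalar_prod_def flip: lessThan_atLeast0)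

lemma indexed_mat_mult_vec:
  assumes "finite B"
  shows "indexed_mat A B K *\<^sub>v indexed_vec B h = indexed_vec A (\<lambda>a. \<Sum>b\<in>B. K a b * h b)"
proof (rule eq_vecI)
  fix i assume "i < dim_vec (indexed_vec A (\<lambda>a. \<Sum>b\<in>B. K a b * h b))"
  then show "(indexed_mat A B K *\<^sub>v indexed_vec B h) $ i = indexed_vec A (\<lambda>a. \<Sum>b\<in>B. K a b * h b) $ i"
    using sum_enum_set[OF assms, of "\<lambda>b. K (enum_set A ! i) b * h b"]
    by (simp add: indexed_vec_def indexed_mat_def scalar_prod_def flip: lessThan_atLeast0)
qed (simp add: indexed_vec_def indexed_mat_def)

lemma transpose_indexed_mat:
  assumes "finite A" and "\<And>a b. a \<in> A \<Longrightarrow> b \<in> A \<Longrightarrow> K a b = K b a"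
  shows "transpose_mat (indexed_mat A A K) = indexed_mat A A K"
  using assms bij_betwE[OF bij_betw_enum_set[of A]] by (intro eq_matI) (auto simp: indexed_mat_def)

lemma indexed_mat_cong:
  assumes "finite A" "finite B" "\<And>a b. a \<in> A \<Longrightarrow> b \<in> B \<Longrightarrow> K a b = L a b"
  shows "indexed_mat A B K = indexed_mat A B L"
  using assms bij_betwE[OF bij_betw_enum_set[of A]] bij_betwE[OF bij_betw_enum_set[of B]]
  by (intro eq_matI) (auto simp: indexed_mat_def)

lemma sigma2_indexed_mat_le:
  assumes "finite A" "finite B" "0 \<le> c"
    and bound: "\<And>h. (\<Sum>b\<in>B. u b * h b) = 0 \<Longrightarrow>
      (\<Sum>a\<in>A. (\<Sum>b\<in>B. K a b * h b)\<^sup>2) \<le> c\<^sup>2 * (\<Sum>b\<in>B. (h b)\<^sup>2)"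
  shows "sigma2 (indexed_mat A B K) \<le> c"
proof (rule sigma2_le[of _ "card A" "card B" "indexed_vec B u"])
  fix x assume "x \<in> carrier_vec (card B)" and orth: "indexed_vec B u \<bullet> x = 0"
  then obtain h where x: "x = indexed_vec B h"
    using indexed_vec_surj[OF \<open>finite B\<close>] by blast
  show "(indexed_mat A B K *\<^sub>v x) \<bullet> (indexed_mat A B K *\<^sub>v x) \<le> c\<^sup>2 * (x \<bullet> x)"
    using orth bound[of h] \<open>finite A\<close> \<open>finite B\<close>
    by (simp add: x indexed_mat_mult_vec scalar_prod_indexed_vec power2_eq_square)
qed (simp_all add: \<open>0 \<le> c\<close>)

text \<open>A symmetric kernel is its own transpose, so its fixed vector is fixed by the Gram matrix
  too, as \<open>norm_mult_mat_vec_le_sigma2\<close> demands.\<close>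

lemma sum_square_le_sigma2_indexed_mat:
  assumes "finite A" and sym: "\<And>a b. a \<in> A \<Longrightarrow> b \<in> A \<Longrightarrow> K a b = K b a"
    and u: "\<And>a. a \<in> A \<Longrightarrow> (\<Sum>b\<in>A. K a b * u b) = u a" "0 < (\<Sum>a\<in>A. (u a)\<^sup>2)"
    and contraction: "\<And>h. (\<Sum>a\<in>A. (\<Sum>b\<in>A. K a b * h b)\<^sup>2) \<le> (\<Sum>b\<in>A. (h b)\<^sup>2)"
    and h: "(\<Sum>a\<in>A. u a * h a) = 0"
  shows "(\<Sum>a\<in>A. (\<Sum>b\<in>A. K a b * h b)\<^sup>2) \<le> (sigma2 (indexed_mat A A K))\<^sup>2 * (\<Sum>a\<in>A. (h a)\<^sup>2)"
proof -
  let ?M = "indexed_mat A A K"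
  have "?M *\<^sub>v indexed_vec A u = indexed_vec A u"
    unfolding indexed_mat_mult_vec[OF \<open>finite A\<close>]
    by (rule indexed_vec_cong) (use \<open>finite A\<close> u in auto)
  then have fix_u: "transpose_mat ?M *\<^sub>v (?M *\<^sub>v indexed_vec A u) = indexed_vec A u"
    using transpose_indexed_mat[OF \<open>finite A\<close> sym] by simp
  have "(?M *\<^sub>v x) \<bullet> (?M *\<^sub>v x) \<le> x \<bullet> x" if x: "x \<in> carrier_vec (card A)" for x
  proof -
    obtain g where "x = indexed_vec A g" using indexed_vec_surj[OF \<open>finite A\<close> x] by blast
    then show ?thesis
      using contraction[of g] \<open>finite A\<close>
      by (simp add: indexed_mat_mult_vec scalar_prod_indexed_vec power2_eq_square)
  qed
  from norm_mult_mat_vec_le_sigma2[where x = "indexed_vec A h", OF indexed_mat_carrier _ _ fix_u this]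
  show ?thesis
    using \<open>finite A\<close> u h
    by (simp add: indexed_mat_mult_vec scalar_prod_indexed_vec power2_eq_square)
qed

section \<open>Weighted graphs\<close>

text \<open>Used twice: for the skeleton of a link, whose second singular value is given, and for
  the k-faces weighted by the swap walk, whose second singular value is wanted.\<close>

locale symmetric_weights =
  fixes F :: "'a set" and w :: "'a \<Rightarrow> 'a \<Rightarrow> real"
  assumes finite_F: "finite F"
    and w_nonneg: "a \<in> F \<Longrightarrow> b \<in> F \<Longrightarrow> 0 \<le> w a b"
    and w_commute: "a \<in> F \<Longrightarrow> b \<in> F \<Longrightarrow> w a b = w b a"
begin

definition deg :: "'a \<Rightarrow> real" where
  "deg a = (\<Sum>b\<in>F. w a b)"

definition kernel :: "'a \<Rightarrow> 'a \<Rightarrow> real" where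
  "kernel a b = w a b / (sqrt (deg a) * sqrt (deg b))"

lemma deg_nonneg: "a \<in> F \<Longrightarrow> 0 \<le> deg a"
  by (simp add: deg_def sum_nonneg w_nonneg)

lemma deg_0:
  assumes "a \<in> F" "b \<in> F" "deg a = 0"
  shows "w a b = 0" "w b a = 0"
proof -
  show "w a b = 0"
    using assms finite_F by (simp add: deg_def sum_nonneg_eq_0_iff w_nonneg)
  then show "w b a = 0" using assms w_commute by metis
qed

lemma sum_w_left: "b \<in> F \<Longrightarrow> (\<Sum>a\<in>F. w a b) = deg b"
  unfolding deg_def by (rule sum.cong) (auto intro: w_commute)

lemma kernel_commute: "a \<in> F \<Longrightarrow> b \<in> F \<Longrightarrow> kernel a b = kernel b a"
  using w_commute by (simp add: kernel_def mult.commute)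

lemma kernel_sqrt_deg:
  assumes "a \<in> F" "b \<in> F"
  shows "sqrt (deg a) * kernel a b = w a b / sqrt (deg b)"
    and "kernel a b * sqrt (deg b) = w a b / sqrt (deg a)"
  using assms deg_0[of a b] deg_0[of b a] by (auto simp: kernel_def)

text \<open>This is the top singular vector that the Courant-Fischer bounds split off; after
  rescaling, orthogonality to it means mean zero with respect to \<open>deg\<close>.\<close>

lemma kernel_fixes_sqrt_deg: "a \<in> F \<Longrightarrow> (\<Sum>b\<in>F. kernel a b * sqrt (deg b)) = sqrt (deg a)"
  by (simp add: kernel_sqrt_deg deg_nonneg real_div_sqrt flip: sum_divide_distrib deg_def)

text \<open>Cauchy-Schwarz in each row, with the kernel split into the square roots of
  \<open>w a b / deg a\<close> and \<open>w a b / deg b\<close>: the first ratios sum to at most 1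
  in a row, and the column sums of \<open>w\<close> cancel the denominators of the second.\<close>

lemma kernel_contraction: "(\<Sum>a\<in>F. (\<Sum>b\<in>F. kernel a b * h b)\<^sup>2) \<le> (\<Sum>b\<in>F. (h b)\<^sup>2)"
proof -
  have "(\<Sum>b\<in>F. kernel a b * h b)\<^sup>2 \<le> (\<Sum>b\<in>F. w a b * ((h b)\<^sup>2 / deg b))" if a: "a \<in> F" for a
  proof -
    have "(\<Sum>b\<in>F. kernel a b * h b) = (\<Sum>b\<in>F. sqrt (w a b / deg a) * (sqrt (w a b / deg b) * h b))"
    proof (rule sum.cong[OF refl])
      fix b assume "b \<in> F"
      then have "sqrt (w a b) * sqrt (w a b) = w a b" using a w_nonneg by simp
      then show "kernel a b * h b = sqrt (w a b / deg a) * (sqrt (w a b / deg b) * h b)"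
        by (simp add: kernel_def real_sqrt_divide)
    qed
    then have "(\<Sum>b\<in>F. kernel a b * h b)\<^sup>2 \<le>
        (\<Sum>b\<in>F. (sqrt (w a b / deg a))\<^sup>2) * (\<Sum>b\<in>F. (sqrt (w a b / deg b) * h b)\<^sup>2)"
      by (simp only: Cauchy_Schwarz_ineq_sum)
    also have "(\<Sum>b\<in>F. (sqrt (w a b / deg a))\<^sup>2) = (\<Sum>b\<in>F. w a b / deg a)"
      using a by (intro sum.cong) (simp_all add: w_nonneg deg_nonneg)
    also have "\<dots> = deg a / deg a"
      by (simp only: deg_def sum_divide_distrib)
    also have "(\<Sum>b\<in>F. (sqrt (w a b / deg b) * h b)\<^sup>2) = (\<Sum>b\<in>F. w a b * ((h b)\<^sup>2 / deg b))"
      using a by (intro sum.cong) (simp_all add: w_nonneg deg_nonneg power_mult_distrib)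
    \<comment> \<open>The quotient is 1, or 0 at a vertex of degree 0.\<close>
    also have "deg a / deg a * \<dots> \<le> 1 * \<dots>"
      using a by (intro mult_right_mono sum_nonneg mult_nonneg_nonneg divide_nonneg_nonneg)
        (simp_all add: w_nonneg deg_nonneg)
    finally show ?thesis by simp
  qed
  then have "(\<Sum>a\<in>F. (\<Sum>b\<in>F. kernel a b * h b)\<^sup>2) \<le> (\<Sum>a\<in>F. \<Sum>b\<in>F. w a b * ((h b)\<^sup>2 / deg b))"
    by (rule sum_mono)
  also have "\<dots> = (\<Sum>b\<in>F. deg b * ((h b)\<^sup>2 / deg b))"
    by (subst sum.swap) (simp only: sum_w_left flip: sum_distrib_right cong: sum.cong)
  also have "\<dots> \<le> (\<Sum>b\<in>F. (h b)\<^sup>2)"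
    by (rule sum_mono) simp
  finally show ?thesis .
qed

text \<open>Rescaling by \<open>sqrt (deg a)\<close> turns the form into an inner product with the
  kernel, and mean zero into orthogonality to its fixed vector. The geometric mean from
  Cauchy-Schwarz is replaced by the arithmetic mean, since sums of energies can later be added over
  links.\<close>

lemma bilinear_le_sigma2:
  assumes sigma: "sigma2 (indexed_mat F F kernel) \<le> c"
    and f: "(\<Sum>a\<in>F. deg a * f a) = 0" and g: "(\<Sum>a\<in>F. deg a * g a) = 0"
  shows "(\<Sum>a\<in>F. \<Sum>b\<in>F. w a b * (f a * g b)) \<le>
    c / 2 * ((\<Sum>a\<in>F. deg a * (f a)\<^sup>2) + (\<Sum>a\<in>F. deg a * (g a)\<^sup>2))"
proof -
  define s where "s = sigma2 (indexed_mat F F kernel)"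
  have s: "0 \<le> s" "s \<le> c" using sigma sigma2_nonneg by (simp_all add: s_def)
  define x where "x = (\<lambda>a. sqrt (deg a) * f a)"
  define y where "y = (\<lambda>a. sqrt (deg a) * g a)"
  define z where "z = (\<lambda>a. \<Sum>b\<in>F. kernel a b * y b)"
  define X Y where "X = (\<Sum>a\<in>F. (x a)\<^sup>2)" and "Y = (\<Sum>a\<in>F. (y a)\<^sup>2)"
  have X: "X = (\<Sum>a\<in>F. deg a * (f a)\<^sup>2)" "Y = (\<Sum>a\<in>F. deg a * (g a)\<^sup>2)"
    by (auto simp: X_def Y_def x_def y_def power_mult_distrib deg_nonneg intro!: sum.cong)
  have nonneg: "0 \<le> X" "0 \<le> Y" by (simp_all add: X_def Y_def sum_nonneg)
  have Z: "(\<Sum>a\<in>F. (z a)\<^sup>2) \<le> s\<^sup>2 * Y"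
  proof (cases "0 < (\<Sum>a\<in>F. (sqrt (deg a))\<^sup>2)")
    case True
    have "(\<Sum>a\<in>F. sqrt (deg a) * y a) = (\<Sum>a\<in>F. deg a * g a)"
      by (rule sum.cong) (simp_all add: y_def deg_nonneg flip: mult.assoc)
    then show ?thesis
      unfolding z_def Y_def s_def using g True
      by (intro sum_square_le_sigma2_indexed_mat finite_F kernel_commute kernel_contraction)
        (auto simp: kernel_fixes_sqrt_deg)
  next
    \<comment> \<open>With all degrees 0 there is no nonzero fixed vector, but then \<open>y\<close>
      and \<open>z\<close> vanish.\<close>
    case False
    then have "(\<Sum>a\<in>F. (sqrt (deg a))\<^sup>2) = 0"
      by (meson linorder_neqE_linordered_idom not_less sum_nonneg zero_le_power2)
    then have "deg a = 0" if "a \<in> F" for a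
      using finite_F that by (simp add: sum_nonneg_eq_0_iff)
    then have "z a = 0" if "a \<in> F" for a by (simp add: z_def y_def)
    then show ?thesis using nonneg by simp
  qed
  have "(\<Sum>a\<in>F. \<Sum>b\<in>F. w a b * (f a * g b)) = (\<Sum>a\<in>F. x a * z a)"
  proof (rule sum.cong[OF refl])
    fix a assume a: "a \<in> F"
    have "w a b * (f a * g b) = x a * (kernel a b * y b)" if b: "b \<in> F" for b
    proof -
      have "sqrt (deg a) * kernel a b * sqrt (deg b) = w a b"
        using kernel_sqrt_deg(1)[OF a b] deg_0(2)[OF b a] by auto
      then show ?thesis by (simp add: x_def y_def mult_ac)
    qed
    then show "(\<Sum>b\<in>F. w a b * (f a * g b)) = x a * z a"
      by (simp add: z_def sum_distrib_left)
  qed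
  also have "\<dots> \<le> s * ((X + Y) / 2)"
  proof (rule power2_le_imp_le)
    have "(\<Sum>a\<in>F. x a * z a)\<^sup>2 \<le> X * (\<Sum>a\<in>F. (z a)\<^sup>2)"
      unfolding X_def by (rule Cauchy_Schwarz_ineq_sum)
    also have "\<dots> \<le> X * (s\<^sup>2 * Y)" using Z nonneg by (intro mult_left_mono)
    also have "\<dots> = s\<^sup>2 * (X * Y)" by simp
    also have "X * Y \<le> ((X + Y) / 2)\<^sup>2"
      using zero_le_power2[of "X - Y"] by (simp add: power2_eq_square field_simps)
    then have "s\<^sup>2 * (X * Y) \<le> s\<^sup>2 * ((X + Y) / 2)\<^sup>2" by (intro mult_left_mono) auto
    also have "\<dots> = (s * ((X + Y) / 2))\<^sup>2" by (rule power_mult_distrib[symmetric])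
    finally show "(\<Sum>a\<in>F. x a * z a)\<^sup>2 \<le> (s * ((X + Y) / 2))\<^sup>2" .
  qed (use s nonneg in simp)
  also have "\<dots> \<le> c * ((X + Y) / 2)" using s nonneg by (intro mult_right_mono) auto
  finally show ?thesis by (simp add: X)
qed

text \<open>The form is tested on \<open>g\<close>, the rescaled \<open>h\<close>, against
  \<open>f\<close>, the rescaled image \<open>z\<close> of \<open>h\<close> under the kernel. Both
  have mean zero, \<open>f\<close> because a symmetric kernel preserves orthogonality to its fixed
  vector.\<close>

lemma sigma2_le_bilinear:
  assumes c: "0 \<le> c"
    and bound: "\<And>f g. (\<Sum>a\<in>F. deg a * f a) = 0 \<Longrightarrow> (\<Sum>a\<in>F. deg a * g a) = 0 \<Longrightarrow>
      (\<Sum>a\<in>F. \<Sum>b\<in>F. w a b * (f a * g b)) \<le>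
      c / 2 * ((\<Sum>a\<in>F. deg a * (f a)\<^sup>2) + (\<Sum>a\<in>F. deg a * (g a)\<^sup>2))"
  shows "sigma2 (indexed_mat F F kernel) \<le> c"
proof (rule sigma2_indexed_mat_le[OF finite_F finite_F c])
  fix h assume h: "(\<Sum>b\<in>F. sqrt (deg b) * h b) = 0"
  define z where "z = (\<lambda>a. \<Sum>b\<in>F. kernel a b * h b)"
  define g where "g = (\<lambda>b. h b / sqrt (deg b))"
  define Z H where "Z = (\<Sum>a\<in>F. (z a)\<^sup>2)" and "H = (\<Sum>b\<in>F. (h b)\<^sup>2)"
  have g: "(\<Sum>a\<in>F. deg a * g a) = 0"
  proof -
    have "(\<Sum>a\<in>F. deg a * g a) = (\<Sum>b\<in>F. sqrt (deg b) * h b)"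
      by (rule sum.cong) (simp_all add: g_def deg_nonneg real_div_sqrt flip: times_divide_eq_left)
    with h show ?thesis by simp
  qed
  have sz: "sqrt (deg a) * z a = (\<Sum>b\<in>F. w a b * g b)" if "a \<in> F" for a
    using that by (simp add: z_def g_def sum_distrib_left kernel_sqrt_deg flip: mult.assoc)
  have sz0: "(\<Sum>a\<in>F. sqrt (deg a) * z a) = 0"
  proof -
    have "(\<Sum>a\<in>F. sqrt (deg a) * z a) = (\<Sum>a\<in>F. \<Sum>b\<in>F. w a b * g b)"
      by (simp add: sz)
    also have "\<dots> = (\<Sum>b\<in>F. deg b * g b)"
      by (subst sum.swap) (simp only: sum_w_left flip: sum_distrib_right cong: sum.cong)
    finally show ?thesis using g by simp
  qed
  \<comment> \<open>The free scaling \<open>t\<close> turns the additive bound back into a multiplicative one.\<close>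
  have *: "t * Z \<le> c / 2 * (t\<^sup>2 * Z + H)" for t
  proof -
    define f where "f = (\<lambda>a. t * (z a / sqrt (deg a)))"
    have "(\<Sum>a\<in>F. deg a * f a) = (\<Sum>a\<in>F. t * (sqrt (deg a) * z a))"
    proof (rule sum.cong[OF refl])
      fix a assume "a \<in> F"
      then have "deg a / sqrt (deg a) = sqrt (deg a)" by (simp add: deg_nonneg real_div_sqrt)
      then have "t * z a * (deg a / sqrt (deg a)) = t * z a * sqrt (deg a)" by simp
      then show "deg a * f a = t * (sqrt (deg a) * z a)" by (simp add: f_def mult_ac)
    qed
    also have "\<dots> = 0" using sz0 by (simp flip: sum_distrib_left)
    finally have f: "(\<Sum>a\<in>F. deg a * f a) = 0" .
    have "t * Z = (\<Sum>a\<in>F. \<Sum>b\<in>F. w a b * (f a * g b))"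
      unfolding Z_def sum_distrib_left
    proof (rule sum.cong[OF refl])
      fix a assume a: "a \<in> F"
      have "(\<Sum>b\<in>F. w a b * (f a * g b)) = f a * (sqrt (deg a) * z a)"
        unfolding sz[OF a] by (simp add: sum_distrib_left mult_ac)
      also have "\<dots> = t * (z a)\<^sup>2"
      proof (cases "deg a = 0")
        case True
        then have "z a = 0" by (simp add: z_def kernel_def)
        then show ?thesis by simp
      qed (simp add: f_def power2_eq_square)
      finally show "t * (z a)\<^sup>2 = (\<Sum>b\<in>F. w a b * (f a * g b))" by simp
    qed
    also have "\<dots> \<le> c / 2 * ((\<Sum>a\<in>F. deg a * (f a)\<^sup>2) + (\<Sum>a\<in>F. deg a * (g a)\<^sup>2))"
      by (rule bound[OF f g])
    also have "\<dots> \<le> c / 2 * (t\<^sup>2 * Z + H)"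
    proof (intro mult_left_mono add_mono)
      show "(\<Sum>a\<in>F. deg a * (f a)\<^sup>2) \<le> t\<^sup>2 * Z"
        unfolding Z_def sum_distrib_left
        by (rule sum_mono) (simp add: f_def deg_nonneg power_mult_distrib power_divide)
      \<comment> \<open>Only an inequality: at a vertex of degree 0 the function \<open>g\<close>
        vanishes while \<open>h\<close> may not.\<close>
      show "(\<Sum>a\<in>F. deg a * (g a)\<^sup>2) \<le> H"
        unfolding H_def by (rule sum_mono) (simp add: g_def deg_nonneg power_divide)
    qed (use c in simp)
    finally show ?thesis .
  qed
  \<comment> \<open>\<open>t = 1 / c\<close> is the scaling that makes the bound sharpest; for
    \<open>c = 0\<close> the choice \<open>t = 1\<close> gives \<open>Z \<le> 0\<close>.\<close>
  have "Z \<le> c\<^sup>2 * H"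
  proof (cases "c = 0")
    case True
    then show ?thesis using *[of 1] by simp
  next
    case False
    then show ?thesis using *[of "1 / c"] c
      by (simp add: power2_eq_square field_simps)
  qed
  then show "(\<Sum>a\<in>F. (\<Sum>b\<in>F. kernel a b * h b)\<^sup>2) \<le> c\<^sup>2 * (\<Sum>b\<in>F. (h b)\<^sup>2)"
    by (simp add: Z_def H_def z_def)
qed

end

section \<open>Exchangeable weights\<close>

definition tuples :: "'a set \<Rightarrow> nat \<Rightarrow> 'a list set" where
  "tuples V k = {xs. set xs \<subseteq> V \<and> length xs = k}"

lemma tuples_0 [simp]: "tuples V 0 = {[]}"
  by (auto simp: tuples_def)

lemma finite_tuples [simp]: "finite V \<Longrightarrow> finite (tuples V k)"
  by (simp add: tuples_def finite_lists_length_eq)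

lemma sum_tuples_Suc:
  "(\<Sum>xs\<in>tuples V (Suc k). F xs) = (\<Sum>v\<in>V. \<Sum>xs\<in>tuples V k. F (v # xs))"
proof -
  have "tuples V (Suc k) = (\<lambda>(v, xs). v # xs) ` (V \<times> tuples V k)"
    by (force simp: tuples_def length_Suc_conv image_iff)
  moreover have "inj_on (\<lambda>(v, xs). v # xs) (V \<times> tuples V k)"
    by (auto simp: inj_on_def)
  ultimately show ?thesis
    by (simp add: sum.reindex sum.cartesian_product case_prod_unfold)
qed

lemma sum_tuples_1: "(\<Sum>xs\<in>tuples V 1. F xs) = (\<Sum>v\<in>V. F [v])"
  using sum_tuples_Suc[of F V 0] by simp

text \<open>\<open>Q A\<close> stands for the probability that a random sequence starts with the
  entries of \<open>A\<close> in a fixed order. The multiset argument encodes exchangeability, and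
  \<open>Q_extend\<close> marginalizes the next entry, up to length \<open>d\<close>.\<close>

locale exchangeable =
  fixes V :: "'a set" and Q :: "'a multiset \<Rightarrow> real" and d :: nat
  assumes finite_V [simp]: "finite V"
    and Q_nonneg: "0 \<le> Q A"
    and Q_extend: "size A < d \<Longrightarrow> (\<Sum>v\<in>V. Q (add_mset v A)) = Q A"
begin

text \<open>Adding \<open>A\<close> inside \<open>Q\<close> passes to the link of \<open>A\<close>
  without renormalizing: \<open>pairing\<close>, \<open>energy\<close> and \<open>total\<close> are
  the expectations of f g, f^2 and f there, times \<open>Q A\<close>.\<close>

definition pairing :: "'a multiset \<Rightarrow> nat \<Rightarrow> nat \<Rightarrow> ('a list \<Rightarrow> real) \<Rightarrow> ('a list \<Rightarrow> real) \<Rightarrow> real" where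
  "pairing A k l f g = (\<Sum>xs\<in>tuples V k. \<Sum>ys\<in>tuples V l. Q (A + mset xs + mset ys) * (f xs * g ys))"

definition energy :: "'a multiset \<Rightarrow> nat \<Rightarrow> ('a list \<Rightarrow> real) \<Rightarrow> real" where
  "energy A k f = (\<Sum>xs\<in>tuples V k. Q (A + mset xs) * (f xs)\<^sup>2)"

definition total :: "'a multiset \<Rightarrow> nat \<Rightarrow> ('a list \<Rightarrow> real) \<Rightarrow> real" where
  "total A k f = (\<Sum>xs\<in>tuples V k. Q (A + mset xs) * f xs)"

text \<open>The bound \<open>c\<close> on the second singular value of the swap operator in the link
  of \<open>A\<close>, as an inequality of bilinear forms. Both sides are linear in
  \<open>Q\<close>, so contributions of different links can be added.\<close>

definition expands :: "'a multiset \<Rightarrow> nat \<Rightarrow> nat \<Rightarrow> real \<Rightarrow> bool" where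
  "expands A k l c \<longleftrightarrow> (\<forall>f g. total A k f = 0 \<longrightarrow> total A l g = 0 \<longrightarrow>
     pairing A k l f g \<le> c / 2 * (energy A k f + energy A l g))"

lemma energy_nonneg: "0 \<le> energy A k f"
  by (auto simp: energy_def intro!: sum_nonneg mult_nonneg_nonneg Q_nonneg)

lemma sum_tuples_Q: "size A + k \<le> d \<Longrightarrow> (\<Sum>xs\<in>tuples V k. Q (A + mset xs)) = Q A"
proof (induction k arbitrary: A)
  case (Suc k)
  have "(\<Sum>xs\<in>tuples V (Suc k). Q (A + mset xs)) = (\<Sum>v\<in>V. \<Sum>xs\<in>tuples V k. Q (add_mset v A + mset xs))"
    by (simp add: sum_tuples_Suc)
  also have "\<dots> = (\<Sum>v\<in>V. Q (add_mset v A))"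
    using Suc.prems by (intro sum.cong refl Suc.IH) simp
  also have "\<dots> = Q A" using Suc.prems by (intro Q_extend) simp
  finally show ?case .
qed simp

lemma pairing_commute: "pairing A k l f g = pairing A l k g f"
  unfolding pairing_def by (subst sum.swap) (simp add: mult_ac add_ac)

text \<open>The swap operators in the two directions are adjoint to each other.\<close>

lemma expands_commute: "expands A k l c \<Longrightarrow> expands A l k c"
  unfolding expands_def by (metis pairing_commute add.commute)

section \<open>Means, variances and covariances within a link\<close>

lemma pairing_const_left:
  assumes "size A + k + l \<le> d"
  shows "pairing A k l (\<lambda>_. a) g = a * total A l g"
proof -
  have "pairing A k l (\<lambda>_. a) g = (\<Sum>ys\<in>tuples V l. (\<Sum>xs\<in>tuples V k. Q ((A + mset ys) + mset xs)) * (a * g ys))"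
    unfolding pairing_def by (subst sum.swap) (simp add: sum_distrib_right add_ac)
  also have "\<dots> = (\<Sum>ys\<in>tuples V l. Q (A + mset ys) * (a * g ys))"
  proof (rule sum.cong[OF refl])
    fix ys assume "ys \<in> tuples V l"
    then have "size (A + mset ys) + k \<le> d" using assms by (simp add: tuples_def)
    then show "(\<Sum>xs\<in>tuples V k. Q ((A + mset ys) + mset xs)) * (a * g ys) = Q (A + mset ys) * (a * g ys)"
      by (simp only: sum_tuples_Q)
  qed
  finally show ?thesis by (simp add: total_def sum_distrib_left mult_ac)
qed

lemma pairing_const_right:
  "size A + k + l \<le> d \<Longrightarrow> pairing A k l f (\<lambda>_. a) = a * total A k f"
  using pairing_const_left[of A l k a f] by (simp add: pairing_commute[of A k l] add_ac)

lemma total_const: "size A + k \<le> d \<Longrightarrow> total A k (\<lambda>_. a) = a * Q A"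
  using sum_tuples_Q[of A k] by (simp add: total_def mult.commute flip: sum_distrib_left)

lemma Q_0_extend:
  assumes "Q A = 0" and xs: "xs \<in> tuples V k" and "size A + k \<le> d"
  shows "Q (A + mset xs) = 0"
proof -
  have "(\<Sum>xs\<in>tuples V k. Q (A + mset xs)) = 0" using sum_tuples_Q assms by simp
  then show ?thesis using xs by (subst (asm) sum_nonneg_eq_0_iff) (auto simp: Q_nonneg)
qed

text \<open>The value is \<open>0\<close> if \<open>Q A = 0\<close>; this is harmless because all terms of \<open>total A k f\<close>
  then vanish.\<close>

definition mean :: "'a multiset \<Rightarrow> nat \<Rightarrow> ('a list \<Rightarrow> real) \<Rightarrow> real" where
  "mean A k f = total A k f / Q A"

lemma total_eq_mean:
  assumes "size A + k \<le> d"
  shows "total A k f = Q A * mean A k f"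
proof (cases "Q A = 0")
  case True
  then show ?thesis using Q_0_extend[OF True _ assms] by (simp add: total_def)
qed (simp add: mean_def)

lemma total_diff: "total A k (\<lambda>xs. f xs - g xs) = total A k f - total A k g"
  by (simp add: total_def right_diff_distrib sum_subtractf)

lemma total_center:
  "size A + k \<le> d \<Longrightarrow> total A k (\<lambda>xs. f xs - mean A k f) = 0"
  by (simp add: total_diff total_const total_eq_mean[of A k f] mult.commute)

text \<open>The variance identity, multiplied by \<open>Q A\<close>.\<close>

lemma energy_center:
  assumes "size A + k \<le> d"
  shows "energy A k (\<lambda>xs. f xs - mean A k f) = energy A k f - Q A * (mean A k f)\<^sup>2"
proof -
  let ?m = "mean A k f"
  have "energy A k (\<lambda>xs. f xs - ?m) =
      (\<Sum>xs\<in>tuples V k. Q (A + mset xs) * (f xs)\<^sup>2 - 2 * ?m * (Q (A + mset xs) * f xs) + ?m\<^sup>2 * Q (A + mset xs))"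
    unfolding energy_def by (rule sum.cong) (simp_all add: power2_eq_square algebra_simps)
  also have "\<dots> = energy A k f - 2 * ?m * total A k f + ?m\<^sup>2 * Q A"
    using sum_tuples_Q[OF assms]
    by (simp add: energy_def total_def sum.distrib sum_subtractf flip: sum_distrib_left)
  finally show ?thesis
    by (simp add: total_eq_mean[OF assms] power2_eq_square algebra_simps)
qed

text \<open>The covariance identity; its mixed terms reduce to totals because constants see only
  marginals.\<close>

lemma pairing_center:
  assumes "size A + k + l \<le> d"
  shows "pairing A k l (\<lambda>xs. f xs - mean A k f) (\<lambda>ys. g ys - mean A l g) =
    pairing A k l f g - Q A * (mean A k f * mean A l g)"
proof -
  let ?m = "mean A k f" and ?m' = "mean A l g"
  have "pairing A k l (\<lambda>xs. f xs - ?m) (\<lambda>ys. g ys - ?m') =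
      pairing A k l f g - pairing A k l f (\<lambda>_. ?m') - pairing A k l (\<lambda>_. ?m) g
        + pairing A k l (\<lambda>_. ?m) (\<lambda>_. ?m')"
    by (simp add: pairing_def algebra_simps sum.distrib sum_subtractf)
  also have "\<dots> = pairing A k l f g - ?m' * total A k f - ?m * total A l g + ?m * total A l (\<lambda>_. ?m')"
    using assms by (simp add: pairing_const_left pairing_const_right)
  finally show ?thesis
    using assms by (simp add: total_const total_eq_mean[of A k f] total_eq_mean[of A l g] mult_ac)
qed

section \<open>Conditioning on the first vertex of the second tuple\<close>

lemma pairing_Suc:
  "pairing A k (Suc l) f g = (\<Sum>v\<in>V. pairing (add_mset v A) k l f (\<lambda>ys. g (v # ys)))"
  unfolding pairing_def sum_tuples_Suc by (subst sum.swap) simp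

lemma energy_Suc: "energy A (Suc l) g = (\<Sum>v\<in>V. energy (add_mset v A) l (\<lambda>ys. g (v # ys)))"
  unfolding energy_def sum_tuples_Suc by simp

lemma total_Suc: "total A (Suc l) g = (\<Sum>v\<in>V. total (add_mset v A) l (\<lambda>ys. g (v # ys)))"
  unfolding total_def sum_tuples_Suc by simp

text \<open>\<open>f\<close> does not depend on \<open>v\<close>, so summing over \<open>v\<close>
  marginalizes one further entry; the strict bound leaves room for it.\<close>

lemma sum_energy:
  assumes "size A + k < d"
  shows "(\<Sum>v\<in>V. energy (add_mset v A) k f) = energy A k f"
proof -
  have "(\<Sum>v\<in>V. energy (add_mset v A) k f) =
      (\<Sum>xs\<in>tuples V k. (\<Sum>v\<in>V. Q (add_mset v (A + mset xs))) * (f xs)\<^sup>2)"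
    unfolding energy_def by (subst sum.swap) (simp add: sum_distrib_right)
  also have "\<dots> = energy A k f"
    unfolding energy_def
  proof (rule sum.cong[OF refl])
    fix xs assume "xs \<in> tuples V k"
    then have "size (A + mset xs) < d" using assms by (simp add: tuples_def)
    then show "(\<Sum>v\<in>V. Q (add_mset v (A + mset xs))) * (f xs)\<^sup>2 = Q (A + mset xs) * (f xs)\<^sup>2"
      by (simp only: Q_extend)
  qed
  finally show ?thesis .
qed

text \<open>A function of the empty tuple is a constant, so the pairing is a multiple of the
  vanishing total of \<open>f\<close>.\<close>

lemma expands_0: "expands A k 0 0"
proof -
  have "pairing A k 0 f g = g [] * total A k f" for f g
    by (simp add: pairing_def total_def sum_distrib_left mult_ac)
  then show ?thesis by (simp add: expands_def)
qed

text \<open>The law of total covariance: the covariances inside the links are bounded through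
  \<open>c'\<close>, the covariance of the conditional means \<open>p\<close> and \<open>q\<close>
  through \<open>c\<close>. Neither centring nor averaging increases energy, so both bounds end in
  the same two energies.\<close>

lemma expands_Suc:
  assumes size: "size A + k + Suc l \<le> d" and "0 \<le> c" and "0 \<le> c'"
    and base: "expands A k 1 c"
    and link: "\<And>v. v \<in> V \<Longrightarrow> expands (add_mset v A) k l c'"
  shows "expands A k (Suc l) (c + c')"
  unfolding expands_def
proof (intro allI impI)
  fix f g assume f: "total A k f = 0" and g: "total A (Suc l) g = 0"
  define B where "B = (\<lambda>v. add_mset v A)"
  define G where "G = (\<lambda>v ys. g (v # ys))"
  define p where "p = (\<lambda>v. mean (B v) k f)"
  define q where "q = (\<lambda>v. mean (B v) l (G v))"
  have sB: "size (B v) + k + l \<le> d" "size (B v) + k \<le> d" "size (B v) + l \<le> d" for v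
    using size by (simp_all add: B_def)
  have energy_p: "energy (B v) k (\<lambda>xs. f xs - p v) \<le> energy (B v) k f" for v
    using sB Q_nonneg by (simp add: p_def energy_center)
  have energy_q: "energy (B v) l (\<lambda>ys. G v ys - q v) = energy (B v) l (G v) - Q (B v) * (q v)\<^sup>2" for v
    using sB by (simp add: q_def energy_center)
  have sum_f: "(\<Sum>v\<in>V. energy (B v) k f) = energy A k f"
    using size by (simp add: B_def sum_energy)
  have sum_g: "(\<Sum>v\<in>V. energy (B v) l (G v)) = energy A (Suc l) g"
    by (simp add: B_def G_def energy_Suc)
  have energy_hd: "energy A 1 (\<lambda>ys. q (hd ys)) = (\<Sum>v\<in>V. Q (B v) * (q v)\<^sup>2)"
    unfolding energy_def sum_tuples_1 by (simp add: B_def)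
  \<comment> \<open>Jensen's inequality: the variance of \<open>G v\<close> in each link is
    nonnegative.\<close>
  also have "\<dots> \<le> (\<Sum>v\<in>V. energy (B v) l (G v))"
  proof (rule sum_mono)
    fix v
    have "0 \<le> energy (B v) l (\<lambda>ys. G v ys - q v)" by (rule energy_nonneg)
    then show "Q (B v) * (q v)\<^sup>2 \<le> energy (B v) l (G v)" by (simp add: energy_q)
  qed
  finally have energy_hd_le: "energy A 1 (\<lambda>ys. q (hd ys)) \<le> energy A (Suc l) g"
    by (simp add: sum_g)
  \<comment> \<open>The mean of the conditional means \<open>q\<close> is the mean of
    \<open>g\<close>, hence 0.\<close>
  have "total A 1 (\<lambda>ys. q (hd ys)) = (\<Sum>v\<in>V. total (B v) l (G v))"
    unfolding total_def[of A] sum_tuples_1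
    by (rule sum.cong) (simp_all add: q_def total_eq_mean[OF sB(3)], simp add: B_def)
  also have "\<dots> = 0" using g by (simp add: total_Suc B_def G_def)
  finally have total_hd: "total A 1 (\<lambda>ys. q (hd ys)) = 0" .
  \<comment> \<open>\<open>Q (B v) * p v\<close> is the total of \<open>f\<close> in the link of
    \<open>v\<close>, so \<open>f\<close> itself ends up paired with a function of one vertex, where
    \<open>base\<close> applies.\<close>
  have "(\<Sum>v\<in>V. Q (B v) * (p v * q v)) = pairing A k 1 f (\<lambda>ys. q (hd ys))"
  proof -
    have "(\<Sum>v\<in>V. Q (B v) * (p v * q v)) = (\<Sum>v\<in>V. total (B v) k f * q v)"
      using sB by (simp add: p_def total_eq_mean mult.assoc)
    also have "\<dots> = (\<Sum>v\<in>V. \<Sum>xs\<in>tuples V k. Q (A + mset xs + mset [v]) * (f xs * q v))"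
      by (simp add: total_def sum_distrib_right B_def mult.assoc)
    also have "\<dots> = pairing A k 1 f (\<lambda>ys. q (hd ys))"
      unfolding pairing_def sum_tuples_1 by (subst sum.swap) simp
    finally show ?thesis .
  qed
  also have "\<dots> \<le> c / 2 * (energy A k f + energy A 1 (\<lambda>ys. q (hd ys)))"
    using base f total_hd unfolding expands_def by blast
  also have "\<dots> \<le> c / 2 * (energy A k f + energy A (Suc l) g)"
    using energy_hd_le \<open>0 \<le> c\<close> by (intro mult_left_mono) auto
  finally have 1: "(\<Sum>v\<in>V. Q (B v) * (p v * q v)) \<le> c / 2 * (energy A k f + energy A (Suc l) g)" .
  have "(\<Sum>v\<in>V. pairing (B v) k l (\<lambda>xs. f xs - p v) (\<lambda>ys. G v ys - q v)) \<le>
      (\<Sum>v\<in>V. c' / 2 * (energy (B v) k f + energy (B v) l (G v)))"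
  proof (rule sum_mono)
    fix v assume "v \<in> V"
    then have "expands (B v) k l c'" unfolding B_def by (rule link)
    moreover have "total (B v) k (\<lambda>xs. f xs - p v) = 0" "total (B v) l (\<lambda>ys. G v ys - q v) = 0"
      unfolding p_def q_def using sB by (blast intro: total_center)+
    ultimately have "pairing (B v) k l (\<lambda>xs. f xs - p v) (\<lambda>ys. G v ys - q v) \<le>
        c' / 2 * (energy (B v) k (\<lambda>xs. f xs - p v) + energy (B v) l (\<lambda>ys. G v ys - q v))"
      unfolding expands_def by blast
    also have "\<dots> \<le> c' / 2 * (energy (B v) k f + energy (B v) l (G v))"
      using energy_p[of v] energy_q[of v] Q_nonneg[of "B v"] \<open>0 \<le> c'\<close>
      by (intro mult_left_mono add_mono) auto
    finally show "pairing (B v) k l (\<lambda>xs. f xs - p v) (\<lambda>ys. G v ys - q v) \<le>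
        c' / 2 * (energy (B v) k f + energy (B v) l (G v))" .
  qed
  also have "\<dots> = c' / 2 * (energy A k f + energy A (Suc l) g)"
    by (simp only: sum_f sum_g sum.distrib sum_distrib_left[symmetric])
  finally have 2: "(\<Sum>v\<in>V. pairing (B v) k l (\<lambda>xs. f xs - p v) (\<lambda>ys. G v ys - q v)) \<le>
      c' / 2 * (energy A k f + energy A (Suc l) g)" .
  have "pairing A k (Suc l) f g = (\<Sum>v\<in>V. pairing (B v) k l f (G v))"
    by (simp add: pairing_Suc B_def G_def)
  also have "\<dots> = (\<Sum>v\<in>V. pairing (B v) k l (\<lambda>xs. f xs - p v) (\<lambda>ys. G v ys - q v)) +
      (\<Sum>v\<in>V. Q (B v) * (p v * q v))"
    using sB by (simp add: p_def q_def pairing_center flip: sum.distrib)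
  also have "\<dots> \<le> c' / 2 * (energy A k f + energy A (Suc l) g) + c / 2 * (energy A k f + energy A (Suc l) g)"
    using 1 2 by simp
  also have "\<dots> = (c + c') / 2 * (energy A k f + energy A (Suc l) g)"
    by (simp add: field_simps)
  finally show "pairing A k (Suc l) f g \<le> (c + c') / 2 * (energy A k f + energy A (Suc l) g)" .
qed

text \<open>Each step of the induction on \<open>l\<close> adds the bound for \<open>k\<close>
  against 1. By symmetry this is the bound for 1 against \<open>k\<close>, found by an inner
  induction whose steps add \<gamma>. Both inductions pass to links, so \<open>A\<close> stays
  arbitrary.\<close>

lemma expands_swap:
  assumes \<gamma>: "0 \<le> \<gamma>"
    and link: "\<And>A. size A + 2 \<le> d \<Longrightarrow> expands A 1 1 \<gamma>"
  shows "size A + k + l \<le> d \<Longrightarrow> expands A k l (real (k * l) * \<gamma>)"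
proof (induction l arbitrary: A)
  case 0
  then show ?case using expands_0 by simp
next
  case (Suc l)
  have "size A + 1 + k \<le> d \<Longrightarrow> expands A 1 k (real k * \<gamma>)" for A
  proof (induction k arbitrary: A)
    case 0
    then show ?case using expands_0 by simp
  next
    case (Suc k)
    then have "expands A 1 (Suc k) (\<gamma> + real k * \<gamma>)"
      using \<gamma> by (intro expands_Suc link) auto
    then show ?case by (simp add: algebra_simps)
  qed
  then have "expands A 1 k (real k * \<gamma>)" using Suc.prems by simp
  then have "expands A k 1 (real k * \<gamma>)" by (rule expands_commute)
  then have "expands A k (Suc l) (real k * \<gamma> + real (k * l) * \<gamma>)"
    using \<gamma> Suc by (intro expands_Suc) auto
  then show ?case by (simp add: algebra_simps)
qed

end

section \<open>Weighted complexes\<close>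

text \<open>The tuples that contribute are the permutations of the members of \<open>F\<close>,
  \<open>fact k\<close> for each.\<close>

lemma sum_tuples_distinct:
  assumes V: "finite V" and F: "\<And>a. a \<in> F \<Longrightarrow> a \<subseteq> V \<and> card a = k"
    and 0: "\<And>xs. xs \<in> tuples V k \<Longrightarrow> \<not> (distinct xs \<and> set xs \<in> F) \<Longrightarrow> \<Phi> xs = 0"
    and \<Psi>: "\<And>xs. distinct xs \<Longrightarrow> set xs \<in> F \<Longrightarrow> \<Phi> xs = \<Psi> (set xs)"
  shows "(\<Sum>xs\<in>tuples V k. \<Phi> xs) = fact k * (\<Sum>a\<in>F. \<Psi> a :: real)"
proof -
  have finF: "finite F" using F V by (meson Pow_iff finite_Pow_iff finite_subset subsetI)
  have fin: "finite a" if "a \<in> F" for a using F[OF that] V finite_subset by blast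
  have U: "(\<Union>a\<in>F. permutations_of_set a) \<subseteq> tuples V k"
    using F by (auto simp: tuples_def permutations_of_set_def distinct_card dest: distinct_card)
  have "(\<Sum>xs\<in>tuples V k. \<Phi> xs) = (\<Sum>xs\<in>(\<Union>a\<in>F. permutations_of_set a). \<Phi> xs)"
    using U V 0 by (intro sum.mono_neutral_right) (auto simp: permutations_of_set_def)
  also have "\<dots> = (\<Sum>a\<in>F. \<Sum>xs\<in>permutations_of_set a. \<Phi> xs)"
  proof (intro sum.UNION_disjoint finF ballI impI)
    show "finite (permutations_of_set a)" for a :: "'a set" by simp
  qed (auto simp: permutations_of_set_def)
  also have "\<dots> = (\<Sum>a\<in>F. fact k * \<Psi> a)"
  proof (rule sum.cong[OF refl])
    fix a assume a: "a \<in> F"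
    have "(\<Sum>xs\<in>permutations_of_set a. \<Phi> xs) = (\<Sum>xs\<in>permutations_of_set a. \<Psi> a)"
      using a \<Psi> by (intro sum.cong) (auto simp: permutations_of_set_def)
    then show "(\<Sum>xs\<in>permutations_of_set a. \<Phi> xs) = fact k * \<Psi> a"
      using F[OF a] fin[OF a] by simp
  qed
  finally show ?thesis by (simp add: sum_distrib_left)
qed

section \<open>Distributions on the levels of the complex\<close>

locale weighted_complex =
  fixes n d :: nat and X :: "nat set set" and P :: "nat set pmf"
  assumes complex: "simplicial_complex n X" and top: "set_pmf P \<subseteq> faces X d"
begin

abbreviation level :: "nat \<Rightarrow> nat set \<Rightarrow> real" where
  "level i s \<equiv> pmf (level_pmf d P i) s"

lemma face_subset: "s \<in> X \<Longrightarrow> s \<subseteq> {1..n}"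
  using complex by (auto simp: simplicial_complex_def)

lemma finite_face: "s \<in> X \<Longrightarrow> finite s"
  using face_subset finite_subset by blast

lemma down_closed: "s \<in> X \<Longrightarrow> t \<subseteq> s \<Longrightarrow> t \<in> X"
  using complex by (auto simp: simplicial_complex_def)

lemma finite_faces [simp]: "finite (faces X i)"
proof -
  have "faces X i \<subseteq> Pow {1..n}" using face_subset by (auto simp: faces_def)
  then show ?thesis by (rule finite_subset) simp
qed

lemma level_pmf_Suc: "i < d \<Longrightarrow> level_pmf d P i = bind_pmf (level_pmf d P (Suc i)) delete_random"
  by (simp add: level_pmf_def Suc_diff_Suc[symmetric])

lemma set_delete_random: "finite t \<Longrightarrow> t \<noteq> {} \<Longrightarrow> set_pmf (delete_random t) = (\<lambda>x. t - {x}) ` t"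
  by (simp add: delete_random_def set_pmf_of_set)

lemma set_level_pmf: "i \<le> d \<Longrightarrow> set_pmf (level_pmf d P i) \<subseteq> faces X i"
proof (induction rule: inc_induct)
  case base
  then show ?case using top by (simp add: level_pmf_def)
next
  case (step i)
  show ?case
  proof
    fix s assume "s \<in> set_pmf (level_pmf d P i)"
    then obtain t where t: "t \<in> set_pmf (level_pmf d P (Suc i))" "s \<in> set_pmf (delete_random t)"
      using step by (auto simp: level_pmf_Suc)
    then have "t \<in> faces X (Suc i)" using step by blast
    then have t': "t \<in> X" "card t = Suc i" "finite t" "t \<noteq> {}"
      using finite_face by (auto simp: faces_def)
    then obtain x where "x \<in> t" "s = t - {x}"
      using t set_delete_random by blast
    then show "s \<in> faces X i" using t' down_closed by (auto simp: faces_def)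
  qed
qed

lemma level_0: "i \<le> d \<Longrightarrow> s \<notin> faces X i \<Longrightarrow> level i s = 0"
  using set_level_pmf[of i] by (auto simp: set_pmf_iff)

lemma pmf_delete_random:
  assumes "finite t" "card t = Suc i"
  shows "pmf (delete_random t) s = (if s \<in> (\<lambda>x. t - {x}) ` t then 1 / real (Suc i) else 0)"
proof -
  have inj: "inj_on (\<lambda>x. t - {x}) t" by (auto simp: inj_on_def)
  have "delete_random t = pmf_of_set ((\<lambda>x. t - {x}) ` t)"
    unfolding delete_random_def using assms by (intro map_pmf_of_set_inj inj) auto
  then show ?thesis
    using assms inj by (subst \<open>delete_random t = _\<close>, subst pmf_of_set) (auto simp: card_image)
qed

text \<open>\<open>s\<close> arises from a face of size \<open>Suc i\<close> by deleting its one
  vertex outside \<open>s\<close>, which happens with probability \<open>1 / Suc i\<close>. Where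
  \<open>insert v s\<close> is not a face its mass is 0, so \<open>v\<close> may run over all
  vertices outside \<open>s\<close>.\<close>

lemma sum_level_insert:
  assumes i: "i < d" and s: "finite s" "card s = i"
  shows "(\<Sum>v\<in>{1..n} - s. level (Suc i) (insert v s)) = real (Suc i) * level i s"
proof -
  define T where "T = {t \<in> faces X (Suc i). s \<in> (\<lambda>x. t - {x}) ` t}"
  have face: "finite t \<and> card t = Suc i" if "t \<in> faces X (Suc i)" for t
    using that finite_face by (auto simp: faces_def)
  have "level i s = (\<Sum>t\<in>faces X (Suc i). pmf (delete_random t) s * level (Suc i) t)"
    unfolding level_pmf_Suc[OF i] pmf_bind
    using set_level_pmf[of "Suc i"] i by (intro integral_measure_pmf_real) auto
  also have "\<dots> = (\<Sum>t\<in>T. 1 / real (Suc i) * level (Suc i) t)"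
    using face by (intro sum.mono_neutral_cong_right) (auto simp: T_def pmf_delete_random)
  also have "\<dots> = 1 / real (Suc i) * (\<Sum>t\<in>T. level (Suc i) t)"
    by (simp only: sum_distrib_left)
  finally have "real (Suc i) * level i s = (\<Sum>t\<in>T. level (Suc i) t)"
    by simp
  also have "\<dots> = (\<Sum>t\<in>(\<lambda>v. insert v s) ` ({1..n} - s). level (Suc i) t)"
  proof (rule sum.mono_neutral_left)
    show "T \<subseteq> (\<lambda>v. insert v s) ` ({1..n} - s)"
    proof
      fix t assume "t \<in> T"
      then obtain x where "x \<in> t" "s = t - {x}" "t \<in> X" by (auto simp: T_def faces_def)
      then have "t = insert x s" "x \<in> {1..n} - s" using face_subset[of t] by auto
      then show "t \<in> (\<lambda>v. insert v s) ` ({1..n} - s)" by blast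
    qed
    show "\<forall>t\<in>(\<lambda>v. insert v s) ` ({1..n} - s) - T. level (Suc i) t = 0"
    proof
      fix t assume t: "t \<in> (\<lambda>v. insert v s) ` ({1..n} - s) - T"
      then obtain v where v: "t = insert v s" "v \<notin> s" by blast
      then have "s = t - {v}" "v \<in> t" by auto
      then have "s \<in> (\<lambda>x. t - {x}) ` t" by (rule image_eqI)
      with t have "t \<notin> faces X (Suc i)" by (auto simp: T_def)
      then show "level (Suc i) t = 0" using i by (intro level_0) auto
    qed
  qed simp
  also have "\<dots> = (\<Sum>v\<in>{1..n} - s. level (Suc i) (insert v s))"
    by (subst sum.reindex) (auto simp: inj_on_def)
  finally show ?thesis by simp
qed

section \<open>Level distributions as exchangeable weights\<close>

text \<open>The probability that \<open>size M\<close> distinct vertices, sampled one after the other from a random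
  face, form the multiset \<open>M\<close> in a prescribed order.\<close>

definition Q :: "nat multiset \<Rightarrow> real" where
  "Q M = (if \<forall>x. count M x \<le> 1 then level (size M) (set_mset M) / fact (size M) else 0)"

lemma mset_set_set_mset:
  assumes "\<forall>x. count M x \<le> 1"
  shows "mset_set (set_mset M) = M"
proof (rule multiset_eqI)
  fix x
  have "count M x = 1" if "x \<in># M"
    using that assms by (intro antisym) auto
  then show "count (mset_set (set_mset M)) x = count M x"
    by (simp add: count_mset_set' not_in_iff)
qed

lemma Q_repeated:
  assumes "1 < count M x"
  shows "Q M = 0"
proof -
  have "\<not> (\<forall>x. count M x \<le> 1)" using assms not_le by blast
  then show ?thesis by (simp only: Q_def if_False)
qed

lemma Q_mset_set: "finite s \<Longrightarrow> Q (mset_set s) = level (card s) s / fact (card s)"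
  by (simp add: Q_def count_mset_set')

lemma Q_nonzeroD:
  assumes "Q M \<noteq> 0" "size M \<le> d"
  shows "M = mset_set (set_mset M)" "set_mset M \<in> faces X (size M)"
  using assms level_0[of "size M" "set_mset M"] mset_set_set_mset[of M]
  by (auto simp: Q_def split: if_splits)

text \<open>Marginalization is \<open>sum_level_insert\<close>: its factor
  \<open>Suc (card s)\<close> reduces the factorial to that of the smaller size, and a repeated
  vertex contributes 0.\<close>

sublocale exchangeable "{1..n}" Q d
proof
  fix M :: "nat multiset" assume M: "size M < d"
  show "(\<Sum>v\<in>{1..n}. Q (add_mset v M)) = Q M"
  proof (cases "\<forall>x. count M x \<le> 1")
    case False
    then obtain x where "1 < count M x" by (auto simp: not_le)
    moreover have "count M x \<le> count (add_mset v M) x" for v by simp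
    ultimately have "Q (add_mset v M) = 0" for v using less_le_trans Q_repeated by blast
    then show ?thesis using Q_repeated[OF \<open>1 < count M x\<close>] by simp
  next
    case True
    define s where "s = set_mset M"
    have s: "finite s" "M = mset_set s" using mset_set_set_mset[OF True] by (simp_all add: s_def)
    then have size: "size M = card s" by simp
    have "Q (add_mset v M) = (if v \<in> s then 0 else level (Suc (card s)) (insert v s) / fact (Suc (card s)))" for v
    proof (cases "v \<in> s")
      case True
      then have "1 < count (add_mset v M) v" using s by simp
      from Q_repeated[OF this] show ?thesis using True by simp
    next
      case False
      then have "add_mset v M = mset_set (insert v s)" using s by simp
      moreover have "Q (mset_set (insert v s)) = level (card (insert v s)) (insert v s) / fact (card (insert v s))"
        using s(1) by (intro Q_mset_set) simp
      ultimately show ?thesis using s(1) False by simp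
    qed
    then have "(\<Sum>v\<in>{1..n}. Q (add_mset v M)) =
        (\<Sum>v\<in>{1..n} - s. level (Suc (card s)) (insert v s) / fact (Suc (card s)))"
      by (intro sum.mono_neutral_cong_right) auto
    also have "\<dots> = real (Suc (card s)) * level (card s) s / fact (Suc (card s))"
      using M s size by (simp only: sum_level_insert flip: sum_divide_distrib)
    also have "\<dots> = level (card s) s / fact (card s)"
      by simp
    finally show ?thesis using s by (simp add: Q_mset_set)
  qed
qed (auto simp: Q_def)

section \<open>Expansion of the links\<close>

text \<open>If \<open>Q A\<close> vanishes, so does the pairing. Otherwise \<open>A\<close> lists a
  face \<open>s\<close>, and up to a constant the weights \<open>Q\<close> of two further vertices
  are the edge weights of its link, so \<open>bilinear_le_sigma2\<close> applies.\<close>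

lemma link_expands:
  assumes A: "size A + 2 \<le> d" and \<gamma>: "0 \<le> \<gamma>"
    and sigma: "\<And>s. s \<in> faces X (size A) \<Longrightarrow> sigma2 (link_adjacency X d P s) \<le> \<gamma>"
  shows "expands A 1 1 \<gamma>"
proof (cases "Q A = 0")
  case True
  have 0: "Q (A + mset xs + mset ys) = 0" if "xs \<in> tuples {1..n} 1" "ys \<in> tuples {1..n} 1" for xs ys
    using Q_0_extend[OF True, of "xs @ ys" 2] that A by (simp add: tuples_def add.assoc)
  have "pairing A 1 1 f g = 0" for f g
    unfolding pairing_def by (intro sum.neutral ballI) (simp add: 0)
  then show ?thesis unfolding expands_def using \<gamma> energy_nonneg by simp
next
  case False
  define s where "s = set_mset A"
  have s: "finite s" "A = mset_set s" "s \<in> X" "card s = size A"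
    using Q_nonzeroD[OF False] A by (simp_all add: s_def faces_def)
  define N where "N = {v. {v} \<in> faces (link X s) 1}"
  define E where "E = faces (link X s) 2"
  define \<omega> where "\<omega> = (\<lambda>e. level (card s + 2) (s \<union> e))"
  \<comment> \<open>The factorial by which \<open>Q\<close> divides the mass of a face with two
    vertices more than \<open>s\<close>. It scales all weights alike and cancels at the end.\<close>
  define c :: real where "c = fact (card s + 2)"
  have c: "0 < c" by (simp add: c_def)
  have N: "v \<in> N" if "insert v s \<in> X" "v \<notin> s" for v
  proof -
    have "{v} = insert v s - s" using that by auto
    then have "{v} \<in> link X s" using that unfolding link_def by blast
    then show ?thesis by (simp add: N_def faces_def)
  qed
  have N_sub: "N \<subseteq> {1..n}"
  proof
    fix v assume "v \<in> N"
    then obtain t where "t \<in> X" "{v} = t - s" by (auto simp: N_def faces_def link_def)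
    then show "v \<in> {1..n}" using face_subset[of t] by blast
  qed
  then have finN: "finite N" by (rule finite_subset) simp
  have new: "u \<notin> s \<and> v \<notin> s \<and> u \<noteq> v \<and> insert v (insert u s) \<in> X"
    if nz: "Q (add_mset v (add_mset u A)) \<noteq> 0" for u v
  proof -
    have face: "insert v (insert u s) \<in> faces X (card s + 2)"
    proof -
      have "size (add_mset v (add_mset u A)) = card s + 2" by (simp add: s(4))
      moreover have "set_mset (add_mset v (add_mset u A)) = insert v (insert u s)" by (simp add: s_def)
      ultimately show ?thesis using Q_nonzeroD(2)[OF nz] A by (simp add: s(4))
    qed
    then have "card (insert v (insert u s)) = Suc (Suc (card s))" by (simp add: faces_def)
    then have "u \<notin> s \<and> v \<notin> s \<and> u \<noteq> v"
      using s(1) by (auto simp: card_insert_if split: if_splits)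
    with face show ?thesis by (simp add: faces_def)
  qed
  have Q2: "c * Q (add_mset v (add_mset u A)) = level (card s + 2) (s \<union> {u, v})"
    if "u \<notin> s" "v \<notin> s" "u \<noteq> v" for u v
  proof -
    have "add_mset v (add_mset u A) = mset_set (insert v (insert u s))"
      unfolding s(2) using that s(1) by simp
    moreover have "card (insert v (insert u s)) = card s + 2" using that s(1) by simp
    ultimately have "Q (add_mset v (add_mset u A)) = level (card s + 2) (insert v (insert u s)) / c"
      using Q_mset_set[of "insert v (insert u s)"] s(1) by (simp only: c_def finite_insert)
    moreover have "insert v (insert u s) = s \<union> {u, v}" by auto
    ultimately show ?thesis using c by simp
  qed
  \<comment> \<open>Off the edges \<open>Q\<close> vanishes, by repetition or because the set is not
    a face; a pair with \<open>u = v\<close> is not an edge, having one element.\<close>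
  have weight: "edge_weight E \<omega> u v = c * Q (add_mset v (add_mset u A))" for u v
  proof (cases "Q (add_mset v (add_mset u A)) = 0")
    case True
    have "edge_weight E \<omega> u v = 0"
    proof (cases "{u, v} \<in> E")
      case e: True
      then have "u \<noteq> v" by (auto simp: E_def faces_def)
      moreover have "{u, v} \<inter> s = {}" using e by (auto simp: E_def faces_def link_def)
      ultimately show ?thesis
        using e Q2[of u v] True by (simp add: edge_weight_def \<omega>_def)
    qed (simp add: edge_weight_def)
    then show ?thesis using True by simp
  next
    case nz: False
    have "{u, v} = insert v (insert u s) - s" using new[OF nz] by auto
    then have "{u, v} \<in> link X s" using new[OF nz] unfolding link_def by blast
    then have "{u, v} \<in> E" using new[OF nz] by (simp add: E_def faces_def)
    then show ?thesis using new[OF nz] Q2[of u v] by (simp add: edge_weight_def \<omega>_def)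
  qed
  interpret G: symmetric_weights N "edge_weight E \<omega>"
    by unfold_locales (use c in \<open>auto simp: finN weight Q_nonneg add_mset_commute\<close>)
  \<comment> \<open>Subsets of faces are faces, so pairs of positive weight lie in \<open>N\<close>,
    and sums over \<open>{1..n}\<close> shrink to sums over \<open>N\<close>.\<close>
  have out: "Q (add_mset v (add_mset u A)) = 0" if "u \<notin> N \<or> v \<notin> N" for u v
  proof (rule ccontr)
    assume nz: "Q (add_mset v (add_mset u A)) \<noteq> 0"
    then have "insert u s \<in> X" "insert v s \<in> X"
      using new[OF nz] by (blast intro: down_closed[of "insert v (insert u s)"])+
    with new[OF nz] N that show False by blast
  qed
  have restrict: "(\<Sum>v\<in>{1..n}. h v) = (\<Sum>v\<in>N. h v)" if "\<And>v. v \<notin> N \<Longrightarrow> h v = 0" for h :: "nat \<Rightarrow> real"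
    using N_sub that by (intro sum.mono_neutral_right) auto
  have deg: "G.deg u = c * Q (add_mset u A)" for u
  proof -
    have "G.deg u = c * (\<Sum>v\<in>{1..n}. Q (add_mset v (add_mset u A)))"
      by (subst restrict) (simp_all add: out G.deg_def weight sum_distrib_left)
    then show ?thesis using Q_extend[of "add_mset u A"] A by simp
  qed
  have out1: "Q (add_mset u A) = 0" if "u \<notin> N" for u
  proof -
    have "Q (add_mset u A) = (\<Sum>v\<in>{1..n}. Q (add_mset v (add_mset u A)))"
      using A by (intro Q_extend[symmetric]) simp
    then show ?thesis using that by (simp add: out)
  qed
  have "link_adjacency X d P s = normalized_adjacency N E \<omega>"
    unfolding link_adjacency_def N_def E_def \<omega>_def ..
  also have "\<dots> = indexed_mat N N G.kernel"
    unfolding normalized_adjacency_def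
    by (rule indexed_mat_cong[OF finN finN]) (simp add: G.kernel_def G.deg_def weighted_degree_def)
  finally have "link_adjacency X d P s = indexed_mat N N G.kernel" .
  then have sig: "sigma2 (indexed_mat N N G.kernel) \<le> \<gamma>"
    using sigma[of s] s(3,4) by (simp add: faces_def)
  show ?thesis
    unfolding expands_def
  proof (intro allI impI)
    fix f g :: "nat list \<Rightarrow> real"
    assume f: "total A 1 f = 0" and g: "total A 1 g = 0"
    have tot: "(\<Sum>v\<in>N. G.deg v * h [v]) = c * total A 1 h" for h :: "nat list \<Rightarrow> real"
      unfolding total_def sum_tuples_1
      by (subst restrict) (simp_all add: out1 deg sum_distrib_left mult.assoc)
    have en: "(\<Sum>v\<in>N. G.deg v * (h [v])\<^sup>2) = c * energy A 1 h" for h :: "nat list \<Rightarrow> real"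
      unfolding energy_def sum_tuples_1
      by (subst restrict) (simp_all add: out1 deg sum_distrib_left mult.assoc)
    have "c * pairing A 1 1 f g = (\<Sum>u\<in>N. \<Sum>v\<in>N. edge_weight E \<omega> u v * (f [u] * g [v]))"
      unfolding pairing_def sum_tuples_1
      by (subst restrict, simp add: out, subst restrict)
        (simp_all add: out weight sum_distrib_left mult.assoc)
    also have "\<dots> \<le> \<gamma> / 2 * ((\<Sum>a\<in>N. G.deg a * (f [a])\<^sup>2) + (\<Sum>a\<in>N. G.deg a * (g [a])\<^sup>2))"
      by (rule G.bilinear_le_sigma2[OF sig]) (simp_all only: tot f g mult_zero_right)
    also have "\<dots> = c * (\<gamma> / 2 * (energy A 1 f + energy A 1 g))"
      unfolding en by (simp add: algebra_simps)
    finally show "pairing A 1 1 f g \<le> \<gamma> / 2 * (energy A 1 f + energy A 1 g)"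
      using c by simp
  qed
qed

section \<open>The swap walk as a weighted graph on the k-faces\<close>

text \<open>Only the upper face \<open>a \<union> b\<close> leads from \<open>a\<close> to
  \<open>b\<close>, and only if the two are disjoint. The normalization fits because 1 / ((2k)
  choose k) = (k!)^2 / (2k)!, where \<open>Q\<close> supplies the denominator.\<close>

lemma swap_matrix_entry:
  assumes k: "k + k \<le> d" and a: "a \<in> faces X k" and b: "b \<in> faces X k"
  shows "inner_pmf (level_pmf d P k) (unit_fun (level_pmf d P k) a)
      (swap_op X d P k k (unit_fun (level_pmf d P k) b)) =
    (fact k)\<^sup>2 * Q (mset_set a + mset_set b) / (sqrt (level k a) * sqrt (level k b))"
proof -
  let ?p = "level_pmf d P k" and ?C = "real ((k + k) choose k)"
  let ?w = "(fact k)\<^sup>2 * Q (mset_set a + mset_set b)"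
  let ?S = "{t. t \<in> faces X (k + k) \<and> a \<subseteq> t}"
  have fin: "finite a" "finite b" "card a = k" "card b = k"
    using a b finite_face by (auto simp: faces_def)
  have "finite ?S" by simp
  have "?w / level k a / sqrt (level k b) =
      (\<Sum>t\<in>?S. 1 / ?C * (level (k + k) t / level k a) * unit_fun ?p b (t - a))"
  proof (cases "a \<inter> b = {}")
    case True
    have "(\<Sum>t\<in>?S. 1 / ?C * (level (k + k) t / level k a) * unit_fun ?p b (t - a)) =
        (\<Sum>t\<in>?S. if t = a \<union> b then 1 / ?C * (level (k + k) t / level k a) / sqrt (level k b) else 0)"
      using True by (intro sum.cong) (auto simp: unit_fun_def)
    \<comment> \<open>If \<open>a \<union> b\<close> is not a face, no \<open>t\<close> qualifies,
      and the right-hand side is 0 as well.\<close>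
    also have "\<dots> = 1 / ?C * (level (k + k) (a \<union> b) / level k a) / sqrt (level k b)"
      using level_0[OF k, of "a \<union> b"] \<open>finite ?S\<close> by simp
    also have "\<dots> = ?w / level k a / sqrt (level k b)"
    proof -
      have "mset_set a + mset_set b = mset_set (a \<union> b)"
        using fin True by (simp add: mset_set_Union)
      moreover have "card (a \<union> b) = k + k" using fin True by (simp add: card_Un_disjoint)
      ultimately have "?w = (fact k)\<^sup>2 * (level (k + k) (a \<union> b) / fact (k + k))"
        using fin by (simp add: Q_mset_set)
      also have "\<dots> = 1 / ?C * level (k + k) (a \<union> b)"
        by (simp add: binomial_fact power2_eq_square)
      finally show ?thesis by simp
    qed
    finally show ?thesis ..
  next
    case False
    then obtain x where "x \<in> a" "x \<in> b" by blast
    then have "1 < count (mset_set a + mset_set b) x" using fin by simp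
    from Q_repeated[OF this] have "?w = 0" by simp
    moreover have "unit_fun ?p b (t - a) = 0" for t
      using \<open>x \<in> a\<close> \<open>x \<in> b\<close> by (auto simp: unit_fun_def)
    ultimately show ?thesis by simp
  qed
  then have "swap_op X d P k k (unit_fun ?p b) a = ?w / level k a / sqrt (level k b)"
    by (simp add: swap_op_def)
  \<comment> \<open>Mass divided by its square root is the square root, also at mass 0, where
    \<open>x / 0 = 0\<close>.\<close>
  moreover have "inner_pmf ?p (unit_fun ?p a) h = sqrt (level k a) * h a" for h
  proof -
    have "inner_pmf ?p (unit_fun ?p a) h = (\<Sum>t\<in>{a}. unit_fun ?p a t * h t * level k t)"
      unfolding inner_pmf_def by (rule integral_measure_pmf_real) (auto simp: unit_fun_def split: if_splits)
    also have "\<dots> = h a * (level k a / sqrt (level k a))" by (simp add: unit_fun_def)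
    finally show ?thesis by (simp only: real_div_sqrt[OF pmf_nonneg] mult.commute)
  qed
  ultimately have "inner_pmf ?p (unit_fun ?p a) (swap_op X d P k k (unit_fun ?p b)) =
      sqrt (level k a) / level k a * (?w / sqrt (level k b))"
    by simp
  also have "sqrt (level k a) / level k a = 1 / sqrt (level k a)"
    by (simp only: sqrt_divide_self_eq[OF pmf_nonneg] inverse_eq_divide)
  finally show ?thesis by simp
qed

text \<open>The matrix of the operator is the normalized adjacency matrix of the graph on k-faces
  with weights \<open>w\<close>, whose degrees are the masses \<open>level k\<close>. Functions of
  faces lift to tuples through \<open>set\<close>, each face counted \<open>fact k\<close> times,
  and \<open>sigma2_le_bilinear\<close> applies.\<close>

lemma swap_sigma2_le:
  assumes k: "k + k \<le> d" and c: "0 \<le> c" and expands: "expands {#} k k c"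
  shows "swap_sigma2 X d P k k \<le> c"
proof -
  define F where "F = faces X k"
  define w where "w = (\<lambda>a b. (fact k)\<^sup>2 * Q (mset_set a + mset_set b))"
  have F: "finite a \<and> a \<subseteq> {1..n} \<and> card a = k" if "a \<in> F" for a
    using that finite_face face_subset by (auto simp: F_def faces_def)
  have finF: "finite F" by (simp add: F_def)
  \<comment> \<open>A tuple of nonzero weight has no repetition, and its entries form a face, being
    part of the face listed by \<open>A + mset xs\<close>.\<close>
  have tuples: "(\<Sum>xs\<in>tuples {1..n} k. Q (A + mset xs) * h (set xs)) =
      fact k * (\<Sum>b\<in>F. Q (A + mset_set b) * h b)" if A: "size A + k \<le> d" for A h
  proof (rule sum_tuples_distinct)
    fix xs assume xs: "xs \<in> tuples {1..n} k" "\<not> (distinct xs \<and> set xs \<in> F)"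
    have "Q (A + mset xs) = 0"
    proof (rule ccontr)
      assume nz: "Q (A + mset xs) \<noteq> 0"
      have sz: "size (A + mset xs) \<le> d" using xs A by (simp add: tuples_def)
      have one: "count (A + mset xs) x \<le> 1" for x
        using Q_repeated[of "A + mset xs" x] nz by (meson not_le)
      have "count (mset xs) x \<le> 1" for x
        using one[of x] by simp
      then have "mset xs = mset_set (set xs)" using mset_set_set_mset[of "mset xs"] by simp
      then have dist: "distinct xs" by (metis mset_eq_mset_set_imp_distinct finite_set)
      have "set xs \<subseteq> set_mset (A + mset xs)" by simp
      then have "set xs \<in> X"
        using Q_nonzeroD(2)[OF nz sz] down_closed by (auto simp: faces_def)
      then show False using xs dist distinct_card[OF dist] by (simp add: F_def faces_def tuples_def)
    qed
    then show "Q (A + mset xs) * h (set xs) = 0" by simp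
  qed (use F in \<open>auto simp: mset_set_set\<close>)
  interpret G: symmetric_weights F w
    by unfold_locales (auto simp: finF w_def Q_nonneg add.commute)
  have Qa: "fact k * Q (mset_set a) = level k a" if "a \<in> F" for a
    using F[OF that] by (simp add: Q_mset_set)
  \<comment> \<open>One factor \<open>fact k\<close> orders the second face, whose sum is a marginal
    of \<open>Q\<close>; the other turns \<open>Q\<close> back into the mass of
    \<open>a\<close>.\<close>
  have deg: "G.deg a = level k a" if a: "a \<in> F" for a
  proof -
    have sz: "size (mset_set a) + k \<le> d" using F[OF a] k by simp
    have "G.deg a = fact k * (fact k * (\<Sum>b\<in>F. Q (mset_set a + mset_set b)))"
      unfolding G.deg_def by (simp add: w_def power2_eq_square sum_distrib_left mult.assoc)
    also have "\<dots> = fact k * Q (mset_set a)"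
      using tuples[OF sz, of "\<lambda>_. 1"] sum_tuples_Q[OF sz] by simp
    finally show ?thesis using Qa[OF a] by simp
  qed
  have deg_sum: "(\<Sum>a\<in>F. G.deg a * h a) = (\<Sum>xs\<in>tuples {1..n} k. Q (mset xs) * h (set xs))" for h
  proof -
    have "(\<Sum>a\<in>F. G.deg a * h a) = fact k * (\<Sum>a\<in>F. Q (mset_set a) * h a)"
      unfolding sum_distrib_left by (rule sum.cong) (simp_all add: deg Qa flip: mult.assoc)
    moreover have "(\<Sum>xs\<in>tuples {1..n} k. Q ({#} + mset xs) * h (set xs)) =
        fact k * (\<Sum>b\<in>F. Q ({#} + mset_set b) * h b)"
      using k by (intro tuples) simp
    ultimately show ?thesis by simp
  qed
  have "sigma2 (indexed_mat F F G.kernel) \<le> c"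
  proof (rule G.sigma2_le_bilinear[OF c])
    fix f g assume f: "(\<Sum>a\<in>F. G.deg a * f a) = 0" and g: "(\<Sum>a\<in>F. G.deg a * g a) = 0"
    let ?f = "\<lambda>xs. f (set xs)" and ?g = "\<lambda>xs. g (set xs)"
    define T where "T = tuples {1..n} k"
    have sum_T: "fact k * (\<Sum>b\<in>F. Q (A + mset_set b) * h b) = (\<Sum>xs\<in>T. Q (A + mset xs) * h (set xs))"
      if "size A = k" for A h
      unfolding T_def using that k by (intro tuples[symmetric]) simp
    \<comment> \<open>The two factors \<open>fact k\<close> are spent in turn: the inner sum over
      faces becomes one over tuples, then, after exchanging the sums, the outer one.\<close>
    have "(\<Sum>a\<in>F. \<Sum>b\<in>F. w a b * (f a * g b)) =
        (\<Sum>a\<in>F. fact k * f a * (fact k * (\<Sum>b\<in>F. Q (mset_set a + mset_set b) * g b)))"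
      unfolding sum_distrib_left by (intro sum.cong refl) (simp add: w_def power2_eq_square)
    also have "\<dots> = (\<Sum>a\<in>F. \<Sum>ys\<in>T. fact k * f a * (Q (mset_set a + mset ys) * g (set ys)))"
    proof (rule sum.cong[OF refl])
      fix a assume "a \<in> F"
      then have "size (mset_set a) = k" using F by simp
      from sum_T[OF this, of g]
      show "fact k * f a * (fact k * (\<Sum>b\<in>F. Q (mset_set a + mset_set b) * g b)) =
          (\<Sum>ys\<in>T. fact k * f a * (Q (mset_set a + mset ys) * g (set ys)))"
        by (simp only: sum_distrib_left[symmetric])
    qed
    also have "\<dots> = (\<Sum>ys\<in>T. \<Sum>a\<in>F. fact k * f a * (Q (mset_set a + mset ys) * g (set ys)))"
      by (rule sum.swap)
    also have "\<dots> = (\<Sum>ys\<in>T. g (set ys) * (fact k * (\<Sum>a\<in>F. Q (mset ys + mset_set a) * f a)))"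
      unfolding sum_distrib_left by (intro sum.cong refl) (simp add: add.commute)
    also have "\<dots> = (\<Sum>ys\<in>T. \<Sum>xs\<in>T. g (set ys) * (Q (mset ys + mset xs) * f (set xs)))"
    proof (rule sum.cong[OF refl])
      fix ys assume "ys \<in> T"
      then have "size (mset ys) = k" by (simp add: T_def tuples_def)
      then show "g (set ys) * (fact k * (\<Sum>a\<in>F. Q (mset ys + mset_set a) * f a)) =
          (\<Sum>xs\<in>T. g (set ys) * (Q (mset ys + mset xs) * f (set xs)))"
        using sum_T[of "mset ys" f] by (simp only: sum_distrib_left[symmetric])
    qed
    also have "\<dots> = (\<Sum>xs\<in>T. \<Sum>ys\<in>T. g (set ys) * (Q (mset ys + mset xs) * f (set xs)))"
      by (rule sum.swap)
    also have "\<dots> = pairing {#} k k ?f ?g"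
      unfolding pairing_def T_def[symmetric] by (intro sum.cong refl) (simp add: add.commute)
    also have "\<dots> \<le> c / 2 * (energy {#} k ?f + energy {#} k ?g)"
    proof -
      have "total {#} k ?f = 0" "total {#} k ?g = 0"
        using f g unfolding total_def deg_sum by simp_all
      then show ?thesis using expands unfolding expands_def by blast
    qed
    finally show "(\<Sum>a\<in>F. \<Sum>b\<in>F. w a b * (f a * g b)) \<le>
        c / 2 * ((\<Sum>a\<in>F. G.deg a * (f a)\<^sup>2) + (\<Sum>a\<in>F. G.deg a * (g a)\<^sup>2))"
      unfolding energy_def deg_sum by simp
  qed
  moreover have "swap_sigma2 X d P k k = sigma2 (indexed_mat F F G.kernel)"
    unfolding swap_sigma2_def op_sigma2_def F_def[symmetric]
  proof (rule arg_cong[of _ _ sigma2], rule indexed_mat_cong[OF finF finF])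
    fix a b assume ab: "a \<in> F" "b \<in> F"
    have "G.kernel a b = (fact k)\<^sup>2 * Q (mset_set a + mset_set b) / (sqrt (level k a) * sqrt (level k b))"
      unfolding G.kernel_def deg[OF ab(1)] deg[OF ab(2)] by (simp add: w_def)
    then show "inner_pmf (level_pmf d P k) (unit_fun (level_pmf d P k) a)
        (swap_op X d P k k (unit_fun (level_pmf d P k) b)) = G.kernel a b"
      using swap_matrix_entry[OF k] ab by (simp add: F_def)
  qed
  ultimately show ?thesis by simp
qed

end

theorem theorem5p1:
  fixes n d k :: nat and X :: "nat set set" and P :: "nat set pmf" and \<gamma> :: real
  assumes "is_HDX n X d P \<gamma>"
    and "d \<ge> 2 * k"
  shows "swap_sigma2 X d P k k \<le> \<gamma> * (2 ^ 7 * real k ^ 4 * 2 ^ (3 * k) * real k ^ k)"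
proof -
  interpret weighted_complex n d X P
    using assms(1) by unfold_locales (simp_all add: is_HDX_def)
  have kd: "k + k \<le> d" using assms(2) by simp
  show ?thesis
  proof (cases "k = 0")
    \<comment> \<open>The claimed bound is 0 because of \<open>real k ^ 4\<close>, whatever the sign
      of \<gamma>, and \<open>expands_0\<close> provides it.\<close>
    case True
    then show ?thesis using swap_sigma2_le[of 0 0] expands_0[of "{#}" 0] by simp
  next
    case False
    have sigma: "sigma2 (link_adjacency X d P s) \<le> \<gamma>" if "s \<in> faces X i" "i + 2 \<le> d" for s i
      using assms(1) that by (auto simp: is_HDX_def)
    obtain t where "t \<in> faces X d" using top set_pmf_not_empty[of P] by blast
    \<comment> \<open>The link of the empty face, a case of the hypothesis since
      \<open>d \<ge> 2\<close>, forces \<gamma> to be nonnegative.\<close>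
    then have "{} \<in> faces X 0" using down_closed[of t "{}"] by (simp add: faces_def)
    then have \<gamma>: "0 \<le> \<gamma>"
      using sigma[of "{}" 0] sigma2_nonneg[of "link_adjacency X d P {}"] kd False by simp
    have "expands {#} k k (real (k * k) * \<gamma>)"
      using kd sigma \<gamma> by (intro expands_swap link_expands) auto
    then have "swap_sigma2 X d P k k \<le> real (k * k) * \<gamma>"
      using kd \<gamma> by (intro swap_sigma2_le) auto
    also have "\<dots> \<le> \<gamma> * (2 ^ 7 * real k ^ 4 * 2 ^ (3 * k) * real k ^ k)"
    proof -
      have k1: "1 \<le> real k" using False by simp
      \<comment> \<open>Factor by factor: \<open>real k ^ 2\<close> is at most
        \<open>real k ^ 4\<close>, and the remaining factors are at least 1.\<close>
      have "real (k * k) = 1 * real k ^ 2 * 1 * 1" by (simp add: power2_eq_square)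
      also have "\<dots> \<le> 2 ^ 7 * real k ^ 4 * 2 ^ (3 * k) * real k ^ k"
        using k1 by (intro mult_mono power_increasing one_le_power mult_nonneg_nonneg) auto
      finally show ?thesis using \<gamma> by (simp add: mult.commute mult_left_mono)
    qed
    finally show ?thesis .
  qed
qed

end
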